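(* Let $n\ge 3$, let $\Omega\subset\mathbb{R}^n$ be a bounded domain, let $1<p<n$, and let $1<q\le\infty$ with $q\ge\frac{np}{np-n+p}$. There exists a constant $C$, independent of $f$, $u$, $\alpha$ and $\beta$, such that for every $f\in L^q(\Omega)$, every weak solution $u$ of $$-\mathrm{div}(|\nabla u|^{p-2}\nabla u)=f\ \text{ in }\Omega,\qquad u=0\ \text{ on }\partial\Omega,$$ and all $\beta>\alpha\ge 0$, $$\lambda_u(\beta)\le\left(\frac{C\,\|f\|_{L^q(\Omega)}\,\lambda_u(\alpha)^{\frac{q-1}{q}}}{(\beta-\alpha)^{p-1}}\right)^{\frac{n}{n-p}},$$ where $\frac{q-1}{q}$ is read as $1$ when $q=\infty$.
   Context: For a measurable function $g$ on $\Omega$, its distribution function is $\lambda_g(\alpha)=m(\{x\in\Omega:|g(x)|>\alpha\})$, where $m$ is Lebesgue measure. $W^{1,p}_0(\Omega)$ is the usual Sobolev space of weakly differentiable functions vanishing on $\partial\Omega$ with weak derivatives in $L^p(\Omega)$ (the closure of $C_0^\infty(\Omega)$ in the $W^{1,p}$ norm). A weak solution of the Dirichlet problem $-\mathrm{div}(|\nabla u|^{p-2}\nabla u)=f$ in $\Omega$, $u=0$ on $\partial\Omega$, is a function $u\in W^{1,p}_0(\Omega)$ such that $$\int_\Omega|\nabla u|^{p-2}\nabla u\cdot\nabla\varphi\,dx=\int_\Omega f\varphi\,dx$$ for every $\varphi\in C_0^\infty(\Omega)$ (equivalently, under the assumption $q\ge\frac{np}{np-n+p}$ on $f\in L^q(\Omega)$,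 for every $\varphi\in W^{1,p}_0(\Omega)$). *)

theory Defs
  imports "HOL-Analysis.Analysis" "HOL-Probability.Essential_Supremum"
begin

(* Euclidean n-space is an arbitrary type 'a :: euclidean_space with n = DIM('a).
   Functions on Omega are total functions; only their values on Omega matter. *)

definition domain_set :: "'a::euclidean_space set \<Rightarrow> bool" where
  "domain_set \<Omega> \<longleftrightarrow> open \<Omega> \<and> connected \<Omega> \<and> \<Omega> \<noteq> {}"

definition distribution_function :: "'a::euclidean_space set \<Rightarrow> ('a \<Rightarrow> real) \<Rightarrow> real \<Rightarrow> real" where
  "distribution_function \<Omega> g \<alpha> = measure lebesgue {x \<in> \<Omega>. \<alpha> < \<bar>g x\<bar>}"

definition Lp_space :: "'a::euclidean_space set \<Rightarrow> ereal \<Rightarrow> ('a \<Rightarrow> 'b::euclidean_space) set" where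
  "Lp_space \<Omega> q = {f. f \<in> borel_measurable (lebesgue_on \<Omega>) \<and>
     (if q = \<infinity> then esssup (lebesgue_on \<Omega>) (\<lambda>x. ereal (norm (f x))) < \<infinity>
      else integrable (lebesgue_on \<Omega>) (\<lambda>x. norm (f x) powr real_of_ereal q))}"

(* Real-valued, hence meaningful only for members of Lp_space Omega q. *)
definition Lp_norm :: "'a::euclidean_space set \<Rightarrow> ereal \<Rightarrow> ('a \<Rightarrow> 'b::euclidean_space) \<Rightarrow> real" where
  "Lp_norm \<Omega> q f =
     (if q = \<infinity> then real_of_ereal (esssup (lebesgue_on \<Omega>) (\<lambda>x. ereal (norm (f x))))
      else (LINT x|lebesgue_on \<Omega>. norm (f x) powr real_of_ereal q) powr (1 / real_of_ereal q))"

primrec C_k :: "nat \<Rightarrow> ('a::euclidean_space \<Rightarrow> real) \<Rightarrow> bool" where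
  "C_k 0 f \<longleftrightarrow> continuous_on UNIV f"
| "C_k (Suc k) f \<longleftrightarrow>
     f differentiable_on UNIV \<and> (\<forall>i\<in>Basis. C_k k (\<lambda>x. frechet_derivative f (at x) i))"

(* Members are extended by zero outside Omega. *)
definition test_functions :: "'a::euclidean_space set \<Rightarrow> ('a \<Rightarrow> real) set" where
  "test_functions \<Omega> =
     {\<phi>. (\<forall>k. C_k k \<phi>) \<and> compact (closure {x. \<phi> x \<noteq> 0}) \<and> closure {x. \<phi> x \<noteq> 0} \<subseteq> \<Omega>}"

definition gradient :: "('a::euclidean_space \<Rightarrow> real) \<Rightarrow> 'a \<Rightarrow> 'a" where
  "gradient \<phi> x = (\<Sum>i\<in>Basis. frechet_derivative \<phi> (at x) i *\<^sub>R i)"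

definition locally_integrable_on ::
    "('a::euclidean_space \<Rightarrow> 'b::euclidean_space) \<Rightarrow> 'a set \<Rightarrow> bool" where
  "locally_integrable_on u \<Omega> \<longleftrightarrow>
     u \<in> borel_measurable (lebesgue_on \<Omega>) \<and>
     (\<forall>K. compact K \<longrightarrow> K \<subseteq> \<Omega> \<longrightarrow> integrable (lebesgue_on K) u)"

definition has_weak_gradient ::
    "'a::euclidean_space set \<Rightarrow> ('a \<Rightarrow> real) \<Rightarrow> ('a \<Rightarrow> 'a) \<Rightarrow> bool" where
  "has_weak_gradient \<Omega> u G \<longleftrightarrow>
     locally_integrable_on u \<Omega> \<and> locally_integrable_on G \<Omega> \<and>
     (\<forall>\<phi>\<in>test_functions \<Omega>. \<forall>i\<in>Basis.
        (LINT x|lebesgue_on \<Omega>. u x * (gradient \<phi> x \<bullet> i)) =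
        - (LINT x|lebesgue_on \<Omega>. (G x \<bullet> i) * \<phi> x))"

definition weakly_differentiable :: "'a::euclidean_space set \<Rightarrow> ('a \<Rightarrow> real) \<Rightarrow> bool" where
  "weakly_differentiable \<Omega> u \<longleftrightarrow> (\<exists>G. has_weak_gradient \<Omega> u G)"

(* Weak gradients are unique up to null sets, so the choice of representative is immaterial. *)
definition weak_gradient :: "'a::euclidean_space set \<Rightarrow> ('a \<Rightarrow> real) \<Rightarrow> 'a \<Rightarrow> 'a" where
  "weak_gradient \<Omega> u = (SOME G. has_weak_gradient \<Omega> u G)"

definition W1p :: "'a::euclidean_space set \<Rightarrow> real \<Rightarrow> ('a \<Rightarrow> real) set" where
  "W1p \<Omega> p = {u. u \<in> Lp_space \<Omega> (ereal p) \<and>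
     weakly_differentiable \<Omega> u \<and> weak_gradient \<Omega> u \<in> Lp_space \<Omega> (ereal p)}"

(* The W^{1,p} norm of a function v whose weak gradient is (a representative) G. *)
definition W1p_norm ::
    "'a::euclidean_space set \<Rightarrow> real \<Rightarrow> ('a \<Rightarrow> real) \<Rightarrow> ('a \<Rightarrow> 'a) \<Rightarrow> real" where
  "W1p_norm \<Omega> p v G =
     (Lp_norm \<Omega> (ereal p) v powr p + Lp_norm \<Omega> (ereal p) G powr p) powr (1 / p)"

(* The closure of the test functions in W^{1,p}; the weak gradient of u - phi is
   the weak gradient of u minus the classical gradient of phi. *)
definition W1p_0 :: "'a::euclidean_space set \<Rightarrow> real \<Rightarrow> ('a \<Rightarrow> real) set" where
  "W1p_0 \<Omega> p = {u \<in> W1p \<Omega> p. \<forall>\<epsilon>>0. \<exists>\<phi>\<in>test_functions \<Omega>.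
     W1p_norm \<Omega> p (\<lambda>x. u x - \<phi> x) (\<lambda>x. weak_gradient \<Omega> u x - gradient \<phi> x) < \<epsilon>}"

(* Where the weak gradient vanishes, the field |Du|^(p-2) Du is 0, also for p < 2
   (0 powr a = 0 for every a). *)
definition p_Laplace_weak_solution ::
    "'a::euclidean_space set \<Rightarrow> real \<Rightarrow> ('a \<Rightarrow> real) \<Rightarrow> ('a \<Rightarrow> real) \<Rightarrow> bool" where
  "p_Laplace_weak_solution \<Omega> p f u \<longleftrightarrow>
     u \<in> W1p_0 \<Omega> p \<and>
     (\<forall>\<phi>\<in>test_functions \<Omega>.
        (LINT x|lebesgue_on \<Omega>.
           norm (weak_gradient \<Omega> u x) powr (p - 2) * (weak_gradient \<Omega> u x \<bullet> gradient \<phi> x)) =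
        (LINT x|lebesgue_on \<Omega>. f x * \<phi> x))"

(* The exponent (q - 1) / q, read as 1 for q = infinity. *)
definition conj_exponent_recip :: "ereal \<Rightarrow> real" where
  "conj_exponent_recip q =
     (if q = \<infinity> then 1 else (real_of_ereal q - 1) / real_of_ereal q)"

end

theory Submission
  imports Defs
begin

text \<open>Let \<open>T\<close> be the odd function that vanishes on \<open>[0, \<alpha>]\<close>, has slope 1 on \<open>[\<alpha>, \<beta>]\<close> and is constant
  afterwards. Testing the equation with \<open>T(u)\<close> gives
  \<open>\<integral>|D T(u)|^p \<le> \<integral> f T(u) \<le> (\<beta> - \<alpha>) \<integral>_{|u| > \<alpha>} |f|\<close>, and the right-hand side is bounded by
  \<open>(\<beta> - \<alpha>) \<parallel>f\<parallel>_q \<lambda>(\<alpha>)^{(q-1)/q}\<close>. Because \<open>|T(u)| = \<beta> - \<alpha>\<close> on \<open>{|u| > \<beta>}\<close>, a weak-type Sobolev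
  inequality for \<open>T(u)\<close> is enough to conclude.

  Chain rules for Sobolev functions are avoided by working with \<open>T_\<delta>(\<phi>)\<close>, where the test functions
  \<open>\<phi>\<close> approximate \<open>u\<close> and \<open>T_\<delta>\<close> is a smooth version of \<open>T\<close>; the limit is taken only in the
  resulting level set estimate. The weak-type Sobolev inequality follows from
  \<open>|\<psi>(x)| \<le> \<integral>_0^\<infinity> |D\<psi>(x + s y)| ds\<close>, averaged over the unit ball in \<open>y\<close>: the part \<open>s > r\<close> is
  bounded pointwise by \<open>r^{1 - n/p} \<parallel>D\<psi>\<parallel>_p\<close> and the part \<open>s < r\<close> in \<open>L^p\<close> by \<open>r \<parallel>D\<psi>\<parallel>_p\<close>, and \<open>r\<close>
  is chosen so that the first is at most half of the level.\<close>

section \<open>Smooth truncations of test functions\<close>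

lemma has_derivative_iff_frechet_derivative:
  "(f has_derivative f') (at x) \<longleftrightarrow> f differentiable (at x) \<and> frechet_derivative f (at x) = f'"
  by (metis differentiableI frechet_derivative_at frechet_derivative_works)

text \<open>\<open>C_k\<close> refers to the choice \<open>frechet_derivative\<close>; by uniqueness
  of derivatives, any explicitly given derivative may replace it.\<close>

lemma C_k_SucI:
  assumes "\<And>x. (f has_derivative f' x) (at x)" "\<And>i. i \<in> Basis \<Longrightarrow> C_k k (\<lambda>x. f' x i)"
  shows "C_k (Suc k) f"
  using assms by (auto simp: has_derivative_iff_frechet_derivative differentiable_on_def)

lemma C_k_SucD:
  assumes "C_k (Suc k) f"
  shows "(f has_derivative frechet_derivative f (at x)) (at x)"
    and "i \<in> Basis \<Longrightarrow> C_k k (\<lambda>x. frechet_derivative f (at x) i)"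
  using assms by (auto simp: has_derivative_iff_frechet_derivative differentiable_on_def)

lemma C_k_Suc_imp: "C_k (Suc k) f \<Longrightarrow> C_k k f"
proof (induction k arbitrary: f)
  case 0
  then show ?case by (auto intro: differentiable_imp_continuous_on)
next
  case (Suc k)
  then show ?case by (intro C_k_SucI[OF C_k_SucD(1)[OF Suc.prems]] Suc.IH C_k_SucD(2)[OF Suc.prems])
qed

lemma C_k_const: "C_k k (\<lambda>x. c)"
proof (induction k arbitrary: c)
  case (Suc k)
  then show ?case by (intro C_k_SucI[where f'="\<lambda>x h. 0"]) auto
qed auto

lemma C_k_add: "C_k k f \<Longrightarrow> C_k k g \<Longrightarrow> C_k k (\<lambda>x. f x + g x)"
proof (induction k arbitrary: f g)
  case (Suc k)
  show ?case
    by (rule C_k_SucI, rule has_derivative_add[OF C_k_SucD(1)[OF Suc.prems(1)] C_k_SucD(1)[OF Suc.prems(2)]])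
      (rule Suc.IH[OF C_k_SucD(2)[OF Suc.prems(1)] C_k_SucD(2)[OF Suc.prems(2)]])
qed (auto intro: continuous_intros)

text \<open>The product rule leaves one factor undifferentiated. It is given at order k + 1 but
  enters the induction hypothesis at order k, hence \<open>C_k_Suc_imp\<close>.\<close>

lemma C_k_mult: "C_k k f \<Longrightarrow> C_k k g \<Longrightarrow> C_k k (\<lambda>x. f x * g x)"
proof (induction k arbitrary: f g)
  case (Suc k)
  show ?case
    by (rule C_k_SucI, rule has_derivative_mult[OF C_k_SucD(1)[OF Suc.prems(1)] C_k_SucD(1)[OF Suc.prems(2)]])
      (rule C_k_add[OF Suc.IH[OF C_k_Suc_imp[OF Suc.prems(1)] C_k_SucD(2)[OF Suc.prems(2)]]
          Suc.IH[OF C_k_SucD(2)[OF Suc.prems(1)] C_k_Suc_imp[OF Suc.prems(2)]]])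
qed (auto intro: continuous_intros)

lemma C_k_diff: "C_k k f \<Longrightarrow> C_k k g \<Longrightarrow> C_k k (\<lambda>x. f x - g x)"
  using C_k_add[OF _ C_k_mult[OF C_k_const[of k "-1"]], of f g] by simp

text \<open>The derivative -f'/f^2 is a product of f' with two copies of 1/f, so order k of 1/f
  itself yields order k + 1.\<close>

lemma C_k_inverse:
  assumes "\<And>x. f x \<noteq> 0"
  shows "C_k k f \<Longrightarrow> C_k k (\<lambda>x. inverse (f x))"
proof (induction k)
  case 0
  then show ?case using assms by (auto intro: continuous_intros)
next
  case (Suc k)
  have IH: "C_k k (\<lambda>x. inverse (f x))"
    using Suc C_k_Suc_imp by auto
  show ?case
  proof (rule C_k_SucI)
    show "((\<lambda>x. inverse (f x)) has_derivative 
       (\<lambda>h. - (inverse (f x) * frechet_derivative f (at x) h * inverse (f x)))) (at x)" for x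
      using Deriv.has_derivative_inverse[OF assms[of x] C_k_SucD(1)[OF Suc.prems(1)]] .
    show "C_k k (\<lambda>x. - (inverse (f x) * frechet_derivative f (at x) i * inverse (f x)))"
      if "i \<in> Basis" for i
      using C_k_diff[OF C_k_const[of k 0] C_k_mult[OF C_k_mult[OF IH C_k_SucD(2)[OF Suc.prems(1) that]] IH]]
      by simp
  qed
qed

text \<open>As for the reciprocal: the derivative f' / (2 sqrt f) involves only f' and the root
  itself, already known at order k.\<close>

lemma C_k_sqrt:
  assumes "\<And>x. f x > 0"
  shows "C_k k f \<Longrightarrow> C_k k (\<lambda>x. sqrt (f x))"
proof (induction k)
  case 0
  then show ?case by (auto intro: continuous_intros)
next
  case (Suc k)
  have IH: "C_k k (\<lambda>x. sqrt (f x))"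
    using Suc C_k_Suc_imp by auto
  have pos: "sqrt (f x) \<noteq> 0" for x using assms[of x] by simp
  show ?case
  proof (rule C_k_SucI)
    show "((\<lambda>x. sqrt (f x)) has_derivative 
       (\<lambda>h. (1/2) * (inverse (sqrt (f x)) * frechet_derivative f (at x) h))) (at x)" for x
      by (rule has_derivative_eq_rhs, rule has_derivative_real_sqrt[OF assms C_k_SucD(1)[OF Suc.prems(1)]])
        (auto simp: field_simps)
    show "C_k k (\<lambda>x. (1/2) * (inverse (sqrt (f x)) * frechet_derivative f (at x) i))"
      if "i \<in> Basis" for i
      by (intro C_k_mult C_k_inverse C_k_const IH C_k_SucD(2)[OF Suc.prems] that) (use pos in auto)
  qed
qed

section \<open>Gradients of test functions\<close>

lemma test_function_has_derivative:
  assumes "\<phi> \<in> test_functions \<Omega>"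
  shows "(\<phi> has_derivative (\<lambda>h. gradient \<phi> x \<bullet> h)) (at x)"
proof -
  have "C_k (Suc 0) \<phi>" using assms by (auto simp: test_functions_def)
  note D = C_k_SucD(1)[OF this, of x]
  then interpret bounded_linear "frechet_derivative \<phi> (at x)"
    by (rule has_derivative_bounded_linear)
  have "frechet_derivative \<phi> (at x) = (\<lambda>h. gradient \<phi> x \<bullet> h)"
  proof
    fix h
    have "frechet_derivative \<phi> (at x) h = frechet_derivative \<phi> (at x) (\<Sum>i\<in>Basis. (h \<bullet> i) *\<^sub>R i)"
      by (simp add: euclidean_representation)
    also have "\<dots> = gradient \<phi> x \<bullet> h"
      by (simp add: gradient_def inner_sum_left sum scaleR mult.commute inner_commute[of h])
    finally show "frechet_derivative \<phi> (at x) h = gradient \<phi> x \<bullet> h" .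
  qed
  with D show ?thesis by simp
qed

lemma gradient_eqI:
  assumes "(f has_derivative (\<lambda>h. g \<bullet> h)) (at x)"
  shows "gradient f x = g"
  unfolding gradient_def frechet_derivative_at[OF assms, symmetric] by (rule euclidean_representation)

lemma continuous_gradient:
  assumes "\<phi> \<in> test_functions \<Omega>"
  shows "continuous_on UNIV (gradient \<phi>)"
proof -
  have "C_k (Suc 0) \<phi>" using assms by (auto simp: test_functions_def)
  from C_k_SucD(2)[OF this] show ?thesis
    unfolding gradient_def by (auto intro!: continuous_intros)
qed

text \<open>The complement of the closed support is open, so the function agrees with 0 near the
  point.\<close>

lemma gradient_zero_outside_support:
  assumes "\<phi> \<in> test_functions \<Omega>" "x \<notin> closure {x. \<phi> x \<noteq> 0}"
  shows "gradient \<phi> x = 0"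
proof (rule gradient_eqI)
  have "((\<lambda>x. 0) has_derivative (\<lambda>h. 0 \<bullet> h)) (at x)" by simp
  then show "(\<phi> has_derivative (\<lambda>h. 0 \<bullet> h)) (at x)"
  proof (rule has_derivative_transform_within_open[of _ _ _ _ "- closure {x. \<phi> x \<noteq> 0}"])
    show "open (- closure {x. \<phi> x \<noteq> 0})" by (rule open_Compl[OF closed_closure])
    show "0 = \<phi> y" if "y \<in> - closure {x. \<phi> x \<noteq> 0}" for y
      using that closure_subset[of "{x. \<phi> x \<noteq> 0}"] by auto
  qed (use assms in auto)
qed

section \<open>The smoothed absolute value and the smoothed truncation\<close>

definition smooth_abs :: "real \<Rightarrow> real \<Rightarrow> real" where
  "smooth_abs e s = sqrt (s\<^sup>2 + e\<^sup>2)"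

text \<open>The function \<open>T\<close> is a combination of four translates of \<open>|s|\<close>; replacing \<open>|s|\<close> by
  \<open>sqrt (s\<^sup>2 + e\<^sup>2)\<close> keeps it odd and keeps its slope between 0 and 1.\<close>

definition smooth_trunc :: "real \<Rightarrow> real \<Rightarrow> real \<Rightarrow> real \<Rightarrow> real" where
  "smooth_trunc e a b s = (smooth_abs e (s + b) - smooth_abs e (s + a)
     + smooth_abs e (s - a) - smooth_abs e (s - b)) / 2"

definition smooth_trunc' :: "real \<Rightarrow> real \<Rightarrow> real \<Rightarrow> real \<Rightarrow> real" where
  "smooth_trunc' e a b s = ((s + b) / smooth_abs e (s + b) - (s + a) / smooth_abs e (s + a)
     + (s - a) / smooth_abs e (s - a) - (s - b) / smooth_abs e (s - b)) / 2"

lemma smooth_abs_pos: "e > 0 \<Longrightarrow> smooth_abs e s > 0"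
  by (simp add: smooth_abs_def add_nonneg_pos)

lemma smooth_abs_derivative:
  assumes "e > 0"
  shows "(smooth_abs e has_real_derivative s / smooth_abs e s) (at s)"
proof -
  have "0 < s\<^sup>2 + e\<^sup>2" using assms by (simp add: add_nonneg_pos)
  then show ?thesis
    unfolding smooth_abs_def[abs_def]
    by (auto intro!: derivative_eq_intros simp: divide_simps)
qed

lemma smooth_abs_derivative_bound: "\<bar>s / smooth_abs e s\<bar> \<le> 1"
proof -
  have "\<bar>s\<bar> \<le> smooth_abs e s"
    unfolding smooth_abs_def by (rule real_le_rsqrt) simp
  then show ?thesis by (auto simp: divide_simps)
qed

text \<open>The smoothed absolute value is convex: its second derivative is e^2 / sqrt(s^2 +
  e^2)^3.\<close>

lemma smooth_abs_derivative_mono: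
  assumes "e > 0" "s \<le> t"
  shows "s / smooth_abs e s \<le> t / smooth_abs e t"
proof -
  have "((\<lambda>s. s / smooth_abs e s) has_real_derivative e\<^sup>2 / (smooth_abs e x)^3) (at x)" for x
  proof -
    have 1: "smooth_abs e x \<noteq> 0" using smooth_abs_pos[OF assms(1)] by (metis less_irrefl)
    have "((\<lambda>s. s / smooth_abs e s) has_real_derivative
       (1 * smooth_abs e x - x * (x / smooth_abs e x)) / (smooth_abs e x * smooth_abs e x)) (at x)"
      using 1 by (intro DERIV_divide smooth_abs_derivative assms DERIV_ident)
    moreover have "smooth_abs e x * smooth_abs e x - x * x = e\<^sup>2"
      by (simp add: smooth_abs_def power2_eq_square)
    then have "(1 * smooth_abs e x - x * (x / smooth_abs e x)) / (smooth_abs e x * smooth_abs e x)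
      = e\<^sup>2 / (smooth_abs e x)^3"
      using 1 by (simp add: field_simps power3_eq_cube)
    ultimately show ?thesis by simp
  qed
  then show ?thesis
    using smooth_abs_pos[OF assms(1)] assms
    by (intro DERIV_nonneg_imp_nondecreasing[OF assms(2)]) (auto intro!: divide_nonneg_pos exI)
qed

lemma smooth_abs_lipschitz:
  assumes "e > 0"
  shows "\<bar>smooth_abs e s - smooth_abs e t\<bar> \<le> \<bar>s - t\<bar>"
  using field_differentiable_bound[of UNIV "smooth_abs e" "\<lambda>s. s / smooth_abs e s" 1 s t]
    smooth_abs_derivative[OF assms] smooth_abs_derivative_bound[of _ e]
  by simp

lemma smooth_abs_approx:
  assumes "e > 0"
  shows "\<bar>smooth_abs e s - \<bar>s\<bar>\<bar> \<le> e"
proof -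
  have "\<bar>s\<bar> \<le> smooth_abs e s"
    unfolding smooth_abs_def by (rule real_le_rsqrt) simp
  moreover have "smooth_abs e s \<le> \<bar>s\<bar> + \<bar>e\<bar>"
    unfolding smooth_abs_def by (rule sqrt_sum_squares_le_sum_abs)
  ultimately show ?thesis using assms by simp
qed

lemma smooth_trunc_derivative:
  assumes "e > 0"
  shows "(smooth_trunc e a b has_real_derivative smooth_trunc' e a b s) (at s)"
proof -
  have "((\<lambda>s. smooth_abs e (s + c)) has_real_derivative (s + c) / smooth_abs e (s + c)) (at s)" for c
    using smooth_abs_derivative[OF assms, of "s + c"] DERIV_shift by blast
  note D = this this[of "- c" for c, simplified]
  show ?thesis
    unfolding smooth_trunc_def[abs_def] smooth_trunc'_def by (intro DERIV_cdivide DERIV_diff DERIV_add D)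
qed

text \<open>For the increasing function h(r) = r / \<open>smooth_abs e r\<close>, the differences
  h(s+b) - h(s+a) and h(s-a) - h(s-b) are nonnegative. For the upper bound the sum is regrouped as
  (h(s+b) - h(s-b)) - (h(s+a) - h(s-a)): the first bracket is at most 2 because |h| \<le> 1, the
  second is nonnegative because 0 \<le> a.\<close>

lemma smooth_trunc'_bounds:
  assumes "e > 0" "0 \<le> a" "a < b"
  shows "0 \<le> smooth_trunc' e a b s" "smooth_trunc' e a b s \<le> 1"
proof -
  define h where "h r = r / smooth_abs e r" for r
  have "h (s + a) \<le> h (s + b)" "h (s - b) \<le> h (s - a)" "h (s - a) \<le> h (s + a)"
    using assms unfolding h_def by (auto intro!: smooth_abs_derivative_mono)
  moreover have "\<bar>h (s + b)\<bar> \<le> 1" "\<bar>h (s - b)\<bar> \<le> 1"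
    unfolding h_def by (rule smooth_abs_derivative_bound)+
  moreover have "smooth_trunc' e a b s = (h (s + b) - h (s + a) + h (s - a) - h (s - b)) / 2"
    unfolding smooth_trunc'_def h_def ..
  ultimately show "0 \<le> smooth_trunc' e a b s" "smooth_trunc' e a b s \<le> 1"
    by auto
qed

lemma abs_half_sum_diff_le:
  fixes x y z w c :: real
  shows "\<bar>x - y\<bar> \<le> c \<Longrightarrow> \<bar>z - w\<bar> \<le> c \<Longrightarrow> \<bar>(x - y + z - w) / 2\<bar> \<le> c"
  using abs_triangle_ineq[of "x - y" "z - w"] by (simp add: add_diff_eq)

text \<open>The four translates form two pairs with arguments b - a apart; each pair contributes at
  most b - a by the Lipschitz bound, and the factor 1/2 averages them.\<close>

lemma smooth_trunc_bound:
  assumes "e > 0" "a < b"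
  shows "\<bar>smooth_trunc e a b s\<bar> \<le> b - a"
  unfolding smooth_trunc_def
  using smooth_abs_lipschitz[OF assms(1), of "s + b" "s + a"]
    smooth_abs_lipschitz[OF assms(1), of "s - a" "s - b"] assms(2)
  by (intro abs_half_sum_diff_le) simp_all

lemma smooth_trunc_0 [simp]: "smooth_trunc e a b 0 = 0"
  by (simp add: smooth_trunc_def smooth_abs_def)

text \<open>The limit case \<open>e = 0\<close> of \<open>smooth_trunc\<close>; for 0 \<le> a < b it
  is the function T described at the outset.\<close>

definition trunc :: "real \<Rightarrow> real \<Rightarrow> real \<Rightarrow> real" where
  "trunc a b s = (\<bar>s + b\<bar> - \<bar>s + a\<bar> + \<bar>s - a\<bar> - \<bar>s - b\<bar>) / 2"

lemma smooth_trunc_approx: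
  assumes "e > 0"
  shows "\<bar>smooth_trunc e a b s - trunc a b s\<bar> \<le> 2 * e"
  using smooth_abs_approx[OF assms, of "s+b"] smooth_abs_approx[OF assms, of "s+a"]
    smooth_abs_approx[OF assms, of "s-a"] smooth_abs_approx[OF assms, of "s-b"]
  unfolding smooth_trunc_def trunc_def abs_le_iff by (simp add: field_simps)

text \<open>The smoothing error is bounded uniformly in the argument, so parameter and argument may
  converge together.\<close>

lemma tendsto_smooth_trunc:
  assumes "\<And>k. e k > 0" "e \<longlonglongrightarrow> 0" "v \<longlonglongrightarrow> s"
  shows "(\<lambda>k. smooth_trunc (e k) a b (v k)) \<longlonglongrightarrow> trunc a b s"
proof -
  have "(\<lambda>k. smooth_trunc (e k) a b (v k) - trunc a b (v k)) \<longlonglongrightarrow> 0"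
  proof (rule Lim_null_comparison)
    show "(\<lambda>k. 2 * e k) \<longlonglongrightarrow> 0" using tendsto_mult_left[OF assms(2), of 2] by simp
  qed (use assms(1) smooth_trunc_approx in auto)
  moreover have "(\<lambda>k. trunc a b (v k)) \<longlonglongrightarrow> trunc a b s"
    unfolding trunc_def by (intro tendsto_intros assms) auto
  ultimately show ?thesis
    using tendsto_add by fastforce
qed

lemma trunc_eq_0:
  assumes "\<bar>s\<bar> \<le> a" "a < b"
  shows "trunc a b s = 0"
proof -
  have "\<bar>s + b\<bar> = s + b" "\<bar>s + a\<bar> = s + a" "\<bar>s - a\<bar> = a - s" "\<bar>s - b\<bar> = b - s"
    using assms by linarith+
  then show ?thesis by (simp add: trunc_def)
qed

lemma abs_trunc_le:
  assumes "a < b"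
  shows "\<bar>trunc a b s\<bar> \<le> b - a"
  unfolding trunc_def
  using abs_triangle_ineq3[of "s + b" "s + a"] abs_triangle_ineq3[of "s - a" "s - b"] assms
  by (intro abs_half_sum_diff_le) simp_all

text \<open>Beyond b the limit |T| equals b - a, which the smooth truncations never exceed, so the
  level b - a itself is out of reach; half of it leaves room. Oddness reduces negative s to positive
  s.\<close>

lemma eventually_abs_smooth_trunc_gt:
  assumes "\<And>k. e k > 0" "e \<longlonglongrightarrow> 0" "v \<longlonglongrightarrow> s" and ab: "0 \<le> a" "a < b" and s: "b < \<bar>s\<bar>"
  shows "eventually (\<lambda>k. (b - a) / 2 < \<bar>smooth_trunc (e k) a b (v k)\<bar>) sequentially"
proof -
  have pos: "trunc a b r = b - a" if "b < r" for r
    using that ab by (simp add: trunc_def abs_of_pos)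
  have odd: "trunc a b (- r) = - trunc a b r" for r
    using abs_minus_cancel[of "r + b"] abs_minus_cancel[of "r + a"]
    by (simp add: trunc_def abs_minus_commute[of a r] abs_minus_commute[of b r]
        minus_divide_left del: divide_minus_left)
  have "\<bar>trunc a b s\<bar> = b - a"
    using pos[of s] pos[of "- s"] odd[of s] ab s by (cases "0 \<le> s") simp_all
  then have "(b - a) / 2 < \<bar>trunc a b s\<bar>" using ab by simp
  with tendsto_rabs[OF tendsto_smooth_trunc[OF assms(1-3)]] show ?thesis
    by (rule order_tendstoD)
qed

text \<open>Each term is the square root of a positive polynomial in \<phi>, so the closure
  properties of \<open>C_k\<close> give smoothness without a general chain rule. The value 0 at 0
  keeps the support inside that of \<phi>.\<close>

lemma smooth_trunc_comp_test_function:
  assumes \<phi>: "\<phi> \<in> test_functions \<Omega>" and e: "e > 0"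
  shows "(\<lambda>x. smooth_trunc e a b (\<phi> x)) \<in> test_functions \<Omega>" (is "?\<psi> \<in> _")
    and "gradient (\<lambda>x. smooth_trunc e a b (\<phi> x)) x = smooth_trunc' e a b (\<phi> x) *\<^sub>R gradient \<phi> x"
proof -
  have C: "C_k k \<phi>" for k using \<phi> by (auto simp: test_functions_def)
  have 1: "C_k k (\<lambda>x. smooth_abs e (\<phi> x + c))" for k c
    unfolding smooth_abs_def power2_eq_square
    using e by (intro C_k_sqrt C_k_add C_k_mult C_k_const C) (auto simp: add_nonneg_pos)
  have "C_k k (\<lambda>x. (1/2) * (smooth_abs e (\<phi> x + b) - smooth_abs e (\<phi> x + a)
     + smooth_abs e (\<phi> x + (- a)) - smooth_abs e (\<phi> x + (- b))))" for k
    by (intro C_k_add C_k_diff C_k_mult C_k_const 1)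
  then have 2: "C_k k ?\<psi>" for k by (simp add: smooth_trunc_def)
  have 3: "closure {x. ?\<psi> x \<noteq> 0} \<subseteq> closure {x. \<phi> x \<noteq> 0}"
    by (rule closure_mono) auto
  have "compact (closure {x. ?\<psi> x \<noteq> 0})"
    using closed_Int_compact[of "closure {x. ?\<psi> x \<noteq> 0}" "closure {x. \<phi> x \<noteq> 0}"] \<phi>
    unfolding Int_absorb2[OF 3] by (auto simp: test_functions_def)
  with 2 3 \<phi> show "?\<psi> \<in> test_functions \<Omega>" by (auto simp: test_functions_def)
  show "gradient ?\<psi> x = smooth_trunc' e a b (\<phi> x) *\<^sub>R gradient \<phi> x"
    by (rule gradient_eqI, rule has_derivative_eq_rhs,
        rule has_derivative_compose[OF test_function_has_derivative[OF \<phi>]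
          smooth_trunc_derivative[OF e, THEN has_field_derivative_imp_has_derivative]]) auto
qed

section \<open>Level sets of weak solutions\<close>

text \<open>Integrating this inequality for a suitable \<open>l\<close> replaces the inequalities of Jensen
  and Hoelder when constants do not matter.\<close>

lemma le_add_powr:
  fixes a l p :: real
  assumes "0 \<le> a" "0 < l" "1 \<le> p"
  shows "a \<le> l + l powr (1 - p) * a powr p"
proof (cases "a \<le> l")
  case True
  then show ?thesis using assms by (simp add: add_increasing2)
next
  case False
  then have "1 \<le> (a / l) powr (p - 1)" using assms by (intro ge_one_powr_ge_zero) auto
  then have "a * 1 \<le> a * (a / l) powr (p - 1)" using assms by (intro mult_left_mono)
  also have "\<dots> = l powr (1 - p) * a powr p"
    using assms False by (simp add: powr_divide powr_diff divide_simps)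
  finally show ?thesis using assms by simp
qed

lemma powr_add_le:
  fixes a b p :: real
  assumes "0 \<le> a" "0 \<le> b" "0 \<le> p"
  shows "(a + b) powr p \<le> 2 powr p * (a powr p + b powr p)"
proof -
  have "(a + b) powr p \<le> (2 * max a b) powr p"
    using assms by (intro powr_mono2) auto
  also have "\<dots> = 2 powr p * max a b powr p"
    using assms by (simp add: powr_mult)
  also have "\<dots> \<le> 2 powr p * (a powr p + b powr p)"
    by (intro mult_left_mono) (auto simp: max_def)
  finally show ?thesis .
qed

lemma powr_pred_le:
  fixes b p :: real
  assumes "0 \<le> b" "1 \<le> p"
  shows "b powr (p - 1) \<le> 1 + b powr p"
proof (cases "b \<le> 1")
  case True
  then have "b powr (p - 1) \<le> 1" using assms by (intro powr_le1) auto
  then show ?thesis by (simp add: add_increasing2)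
next
  case False
  then have "b powr (p - 1) \<le> b powr p" by (intro powr_mono) auto
  then show ?thesis by simp
qed

text \<open>A Young inequality with a small parameter and a non-sharp constant:
  \<open>le_add_powr\<close> for d at the level \<open>e * b\<close>, multiplied by b^(p-1).\<close>

lemma powr_pred_mult_le:
  fixes b d e p :: real
  assumes "0 \<le> b" "0 \<le> d" "0 < e" "1 < p"
  shows "b powr (p - 1) * d \<le> e * b powr p + e powr (1 - p) * d powr p"
proof (cases "b = 0")
  case True
  then show ?thesis using assms by simp
next
  case False
  with assms have b: "b > 0" by simp
  have "b powr (p - 1) * d \<le> b powr (p - 1) * (e * b + (e * b) powr (1 - p) * d powr p)"
    using assms b by (intro mult_left_mono le_add_powr) auto
  also have "\<dots> = e * (b powr (p - 1) * b) + (b powr (p - 1) * b powr (1 - p)) * (e powr (1 - p) * d powr p)"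
    using assms by (simp add: powr_mult algebra_simps)
  also have "b powr (p - 1) * b = b powr p" using b by (simp add: powr_diff)
  also have "b powr (p - 1) * b powr (1 - p) = 1" using b by (simp flip: powr_add)
  finally show ?thesis by simp
qed

text \<open>Intended for G the weak gradient of the solution and a the gradient of a nearby test
  function. Splitting |G|^p into |G|^(p-2) G.a + |G|^(p-2) G.(G - a) exposes the product that occurs
  in the weak equation; \<open>powr_pred_mult_le\<close> absorbs the remainder.\<close>

lemma norm_powr_le_p_Laplace:
  fixes a G :: "'a::real_inner"
  assumes p: "1 < p" and e: "0 < e"
  shows "norm a powr p \<le> 2 powr p * (norm G powr (p - 2) * (G \<bullet> a) + e * norm G powr p
    + (e powr (1 - p) + 1) * norm (G - a) powr p)"
proof -
  have "norm a \<le> norm G + norm (G - a)"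
    by (metis norm_minus_commute norm_triangle_sub)
  then have "norm a powr p \<le> (norm G + norm (G - a)) powr p"
    using p by (intro powr_mono2) auto
  also have "\<dots> \<le> 2 powr p * (norm G powr p + norm (G - a) powr p)"
    using p by (intro powr_add_le) auto
  finally have 1: "norm a powr p \<le> 2 powr p * (norm G powr p + norm (G - a) powr p)" .
  have 2: "norm G powr p \<le> norm G powr (p - 2) * (G \<bullet> a) + norm G powr (p - 1) * norm (G - a)"
  proof (cases "G = 0")
    case False
    have "norm G powr p = norm G powr (p - 2) * (G \<bullet> G)"
      using False by (simp add: dot_square_norm powr_diff)
    also have "\<dots> = norm G powr (p - 2) * (G \<bullet> a) + norm G powr (p - 2) * (G \<bullet> (G - a))"
      by (simp add: algebra_simps)
    also have "norm G powr (p - 2) * (G \<bullet> (G - a)) \<le> norm G powr (p - 2) * (norm G * norm (G - a))"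
      by (intro mult_left_mono norm_cauchy_schwarz) auto
    also have "\<dots> = norm G powr (p - 1) * norm (G - a)"
      using False by (simp add: powr_diff power2_eq_square)
    finally show ?thesis by simp
  qed (use p in auto)
  note 1
  also have "2 powr p * (norm G powr p + norm (G - a) powr p)
    \<le> 2 powr p * (norm G powr (p - 2) * (G \<bullet> a) + e * norm G powr p
    + (e powr (1 - p) + 1) * norm (G - a) powr p)"
    using 2 powr_pred_mult_le[of "norm G" "norm (G - a)" e p] p e
    by (intro mult_left_mono) (auto simp: algebra_simps)
  finally show ?thesis .
qed

section \<open>Approximation, integrability and a Hoelder-type bound\<close>

lemma borel_measurable_lebesgue_on:
  "f \<in> borel_measurable borel \<Longrightarrow> f \<in> borel_measurable (lebesgue_on \<Omega>)"
  by (simp add: measurable_completion measurable_restrict_space1)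

lemma Lp_norm_powr:
  assumes "0 < p"
  shows "Lp_norm \<Omega> (ereal p) f powr p = (LINT x|lebesgue_on \<Omega>. norm (f x) powr p)"
  using assms by (simp add: Lp_norm_def powr_powr Bochner_Integration.integral_nonneg)

lemma W1p_0_approx:
  assumes u: "u \<in> W1p_0 \<Omega> p" and p: "1 < p" and e: "0 < e"
  obtains \<phi> where "\<phi> \<in> test_functions \<Omega>"
    "(LINT x|lebesgue_on \<Omega>. \<bar>u x - \<phi> x\<bar> powr p) < e"
    "(LINT x|lebesgue_on \<Omega>. norm (weak_gradient \<Omega> u x - gradient \<phi> x) powr p) < e"
proof -
  \<comment> \<open>The p-th power of the norm is the sum of the two integrals, hence the tolerance
    e^(1/p).\<close>
  have "e powr (1 / p) > 0" using e by simp
  then obtain \<phi> where \<phi>: "\<phi> \<in> test_functions \<Omega>"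
    "W1p_norm \<Omega> p (\<lambda>x. u x - \<phi> x) (\<lambda>x. weak_gradient \<Omega> u x - gradient \<phi> x) < e powr (1 / p)"
    using u unfolding W1p_0_def by blast
  define A where "A = (LINT x|lebesgue_on \<Omega>. \<bar>u x - \<phi> x\<bar> powr p)"
  define B where "B = (LINT x|lebesgue_on \<Omega>. norm (weak_gradient \<Omega> u x - gradient \<phi> x) powr p)"
  have AB: "A \<ge> 0" "B \<ge> 0" unfolding A_def B_def by (auto intro!: Bochner_Integration.integral_nonneg)
  have "(A + B) powr (1 / p) < e powr (1 / p)"
    using \<phi>(2) p by (simp add: W1p_norm_def Lp_norm_powr A_def B_def)
  then have "A + B < e"
    using powr_mono2[of "1 / p" e "A + B"] e p by (cases "e \<le> A + B") auto
  with AB have "A < e" "B < e" by auto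
  with \<phi>(1) show ?thesis using that unfolding A_def B_def by blast
qed

text \<open>Hoelder's inequality against an indicator, up to the factor 2. For a finite exponent
  \<open>le_add_powr\<close> is integrated at one constant level; at level 1 it also shows f
  integrable, the measure being finite.\<close>

lemma Lp_space_integral_indicator_le:
  fixes f :: "'a::euclidean_space \<Rightarrow> 'b::euclidean_space"
  assumes f: "f \<in> Lp_space \<Omega> q" and q: "1 < q" and \<Omega>: "\<Omega> \<in> lmeasurable"
    and E: "E \<in> sets (lebesgue_on \<Omega>)"
  shows "integrable (lebesgue_on \<Omega>) f"
    and "(LINT x|lebesgue_on \<Omega>. norm (f x) * indicator E x)
      \<le> 2 * Lp_norm \<Omega> q f * measure (lebesgue_on \<Omega>) E powr conj_exponent_recip q"
proof -
  define M where "M = lebesgue_on \<Omega>"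
  interpret finite_measure M
    unfolding M_def using \<Omega> by (rule finite_measure_lebesgue_on)
  have fM[measurable]: "f \<in> borel_measurable M" using f by (auto simp: Lp_space_def M_def)
  have EM[measurable]: "E \<in> sets M" using E by (simp add: M_def)
  have I_nonneg: "0 \<le> (LINT x|M. norm (f x) * indicator E x)"
    by (intro Bochner_Integration.integral_nonneg) auto
  have int_ind: "integrable M (\<lambda>x. c * indicator E x :: real)" for c
    by (intro integrable_mult_right integrable_real_indicator) (auto simp: less_top[symmetric])
  have "integrable M f \<and> (LINT x|M. norm (f x) * indicator E x)
      \<le> 2 * Lp_norm \<Omega> q f * measure M E powr conj_exponent_recip q"
  proof (cases "q = \<infinity>")
    case True
    define S where "S = esssup M (\<lambda>x. ereal (norm (f x)))"
    have "S < \<infinity>" using f True by (simp add: Lp_space_def S_def M_def)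
    have L: "Lp_norm \<Omega> q f = real_of_ereal S" using True by (simp add: Lp_norm_def S_def M_def)
    \<comment> \<open>Should \<open>S\<close> be -\<infinity>, the pointwise implication is vacuous,
      so the real value of \<open>S\<close> may be used in every case.\<close>
    have AE: "AE x in M. norm (f x) \<le> real_of_ereal S"
      using esssup_AE[of "\<lambda>x. ereal (norm (f x))" M] unfolding S_def[symmetric]
      by eventually_elim (use \<open>S < \<infinity>\<close> in \<open>cases S; auto\<close>)
    have int: "integrable M f" by (rule integrable_const_bound[OF AE]) measurable
    have "(LINT x|M. norm (f x) * indicator E x) \<le> (LINT x|M. real_of_ereal S * indicator E x)"
      using AE by (intro integral_mono_AE integrable_mult_indicator int_ind
          Bochner_Integration.integrable_bound[OF int]) (auto simp: indicator_def)
    also have "\<dots> = real_of_ereal S * measure M E" by simp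
    finally have "(LINT x|M. norm (f x) * indicator E x) \<le> real_of_ereal S * measure M E" .
    \<comment> \<open>The integral is nonnegative, hence so is its bound, and doubling is harmless
      whatever the sign of \<open>S\<close>.\<close>
    with I_nonneg have "(LINT x|M. norm (f x) * indicator E x) \<le> 2 * (real_of_ereal S * measure M E)"
      by linarith
    with int show ?thesis
      unfolding L using True by (simp add: conj_exponent_recip_def)
  next
    case False
    with q obtain r where r: "q = ereal r" "1 < r" by (cases q) auto
    have intr: "integrable M (\<lambda>x. norm (f x) powr r)"
      using f r by (simp add: Lp_space_def M_def)
    have int: "integrable M f"
    proof (rule Bochner_Integration.integrable_bound)
      show "integrable M (\<lambda>x. 1 + norm (f x) powr r)" using intr by simp
      show "AE x in M. norm (f x) \<le> norm (1 + norm (f x) powr r)"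
        using le_add_powr[of "norm (f _)" 1 r] r by (auto simp: add_nonneg_nonneg)
    qed measurable
    define N where "N = Lp_norm \<Omega> q f"
    define m where "m = measure M E"
    have N_nonneg: "N \<ge> 0" by (simp add: N_def Lp_norm_def r)
    have Nr: "N powr r = (LINT x|M. norm (f x) powr r)"
      using Lp_norm_powr[of r \<Omega> f] r by (simp add: N_def M_def)
    have ce: "conj_exponent_recip q = 1 - 1 / r"
      using r by (simp add: conj_exponent_recip_def diff_divide_distrib)
    \<comment> \<open>The balancing level used below needs m and N positive; the degenerate cases
      come first.\<close>
    consider "m = 0" | "N = 0" | "m > 0" "N > 0"
      using N_nonneg measure_nonneg[of M E] m_def by linarith
    then have "(LINT x|M. norm (f x) * indicator E x) \<le> 2 * N * m powr (1 - 1 / r)"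
    proof cases
      case 1
      then have "E \<in> null_sets M" by (intro null_setsI) (auto simp: m_def emeasure_eq_measure)
      from AE_not_in[OF this] have "AE x in M. norm (f x) * indicator E x = 0"
        by eventually_elim simp
      then have "(LINT x|M. norm (f x) * indicator E x) = 0"
        by (rule integral_eq_zero_AE)
      then show ?thesis using N_nonneg by simp
    next
      case 2
      then have "(LINT x|M. norm (f x) powr r) = 0" using Nr r by simp
      then have "AE x in M. norm (f x) powr r = 0"
        using integral_nonneg_eq_0_iff_AE[OF intr] by simp
      then have "AE x in M. norm (f x) * indicator E x = 0"
        by eventually_elim auto
      then have "(LINT x|M. norm (f x) * indicator E x) = 0"
        by (rule integral_eq_zero_AE)
      then show ?thesis using N_nonneg by simp
    next
      case 3
      \<comment> \<open>At this level both terms, l m and l^(1-r) N^r, equal N m^(1-1/r).\<close>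
      define l where "l = N / m powr (1 / r)"
      have l: "l > 0" using 3 by (simp add: l_def)
      have "(LINT x|M. norm (f x) * indicator E x)
        \<le> (LINT x|M. l * indicator E x + l powr (1 - r) * norm (f x) powr r)"
      proof (rule integral_mono)
        show "integrable M (\<lambda>x. norm (f x) * indicator E x)"
          by (rule Bochner_Integration.integrable_bound[OF int]) (auto simp: indicator_def)
        show "integrable M (\<lambda>x. l * indicator E x + l powr (1 - r) * norm (f x) powr r)"
          by (intro Bochner_Integration.integrable_add int_ind integrable_mult_right intr)
        show "norm (f x) * indicator E x \<le> l * indicator E x + l powr (1 - r) * norm (f x) powr r" for x
          using le_add_powr[of "norm (f x)" l r] l r by (auto simp: indicator_def)
      qed
      also have "\<dots> = l * m + l powr (1 - r) * N powr r"
        by (subst Bochner_Integration.integral_add[OF int_ind integrable_mult_right[OF intr]]) (simp add: Nr m_def)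
      also have "l * m = N * m powr (1 - 1 / r)"
        using 3 by (simp add: l_def powr_diff)
      also have "l powr (1 - r) * N powr r = N * m powr (1 - 1 / r)"
      proof -
        have "l powr (1 - r) = N powr (1 - r) * m powr (- ((1 / r) * (1 - r)))"
          using 3 by (simp add: l_def powr_divide powr_powr powr_minus_divide)
        also have "- ((1 / r) * (1 - r)) = 1 - 1 / r"
          using r by (simp add: field_simps)
        finally show ?thesis
          using 3 by (simp add: powr_diff)
      qed
      finally show ?thesis by simp
    qed
    with int show ?thesis unfolding ce N_def m_def by simp
  qed
  then show "integrable (lebesgue_on \<Omega>) f"
    and "(LINT x|lebesgue_on \<Omega>. norm (f x) * indicator E x)
      \<le> 2 * Lp_norm \<Omega> q f * measure (lebesgue_on \<Omega>) E powr conj_exponent_recip q"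
    by (auto simp: M_def)
qed

lemma test_function_regularity:
  assumes \<phi>: "\<phi> \<in> test_functions \<Omega>"
  shows "\<phi> \<in> borel_measurable borel" "gradient \<phi> \<in> borel_measurable borel"
    "bounded {x. \<phi> x \<noteq> 0}" "\<exists>B. \<forall>x. \<bar>\<phi> x\<bar> \<le> B" "\<exists>B. \<forall>x. norm (gradient \<phi> x) \<le> B"
proof -
  define S where "S = closure {x. \<phi> x \<noteq> 0}"
  have S: "compact S" using \<phi> by (simp add: test_functions_def S_def)
  have c: "continuous_on UNIV \<phi>"
    using test_function_has_derivative[OF \<phi>]
    by (intro has_derivative_continuous_on) (auto intro: has_derivative_at_withinI)
  then show "\<phi> \<in> borel_measurable borel" by (rule borel_measurable_continuous_onI)
  show "gradient \<phi> \<in> borel_measurable borel"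
    by (rule borel_measurable_continuous_onI[OF continuous_gradient[OF \<phi>]])
  show "bounded {x. \<phi> x \<noteq> 0}"
    by (rule bounded_subset[OF compact_imp_bounded[OF S]]) (auto simp: S_def closure_subset)
  have "bounded (\<phi> ` S)" "bounded (gradient \<phi> ` S)"
    using continuous_on_subset[OF c] continuous_on_subset[OF continuous_gradient[OF \<phi>]] S
    by (auto intro!: compact_imp_bounded compact_continuous_image)
  then obtain B B' where "\<forall>y\<in>\<phi> ` S. norm y \<le> B" "\<forall>y\<in>gradient \<phi> ` S. norm y \<le> B'"
    unfolding bounded_iff by blast
  then have B: "\<And>x. x \<in> S \<Longrightarrow> norm (\<phi> x) \<le> B" "\<And>x. x \<in> S \<Longrightarrow> norm (gradient \<phi> x) \<le> B'"
    by auto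
  have 0: "x \<notin> S \<Longrightarrow> \<phi> x = 0" "x \<notin> S \<Longrightarrow> gradient \<phi> x = 0" for x
    using closure_subset[of "{x. \<phi> x \<noteq> 0}"] gradient_zero_outside_support[OF \<phi>] by (auto simp: S_def)
  have "\<bar>\<phi> x\<bar> \<le> max 0 B" for x using B(1)[of x] 0(1)[of x] by (cases "x \<in> S") auto
  then show "\<exists>B. \<forall>x. \<bar>\<phi> x\<bar> \<le> B" by blast
  have "norm (gradient \<phi> x) \<le> max 0 B'" for x using B(2)[of x] 0(2)[of x] by (cases "x \<in> S") auto
  then show "\<exists>B. \<forall>x. norm (gradient \<phi> x) \<le> B" by blast
qed

lemma integrable_powr_diff:
  fixes u v :: "'a \<Rightarrow> 'b::euclidean_space"
  assumes M: "finite_measure M" and p: "1 < p" and u: "u \<in> borel_measurable M"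
    "integrable M (\<lambda>x. norm (u x) powr p)"
    and v: "v \<in> borel_measurable M" "\<And>x. norm (v x) \<le> B"
  shows "integrable M (\<lambda>x. norm (u x - v x) powr p)"
proof (rule Bochner_Integration.integrable_bound)
  interpret finite_measure M by (rule M)
  note [measurable] = u(1) v(1)
  show "(\<lambda>x. norm (u x - v x) powr p) \<in> borel_measurable M" by measurable
  show "integrable M (\<lambda>x. 2 powr p * (norm (u x) powr p + B powr p))"
    using u(2) by simp
  show "AE x in M. norm (norm (u x - v x) powr p) \<le> norm (2 powr p * (norm (u x) powr p + B powr p))"
  proof (rule AE_I2)
    fix x
    have "norm (u x - v x) powr p \<le> (norm (u x) + norm (v x)) powr p"
      using p by (intro powr_mono2 norm_triangle_ineq4) auto
    also have "\<dots> \<le> 2 powr p * (norm (u x) powr p + norm (v x) powr p)"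
      using p by (intro powr_add_le) auto
    also have "\<dots> \<le> 2 powr p * (norm (u x) powr p + B powr p)"
      using p v(2)[of x] by (intro mult_left_mono add_left_mono powr_mono2) auto
    finally show "norm (norm (u x - v x) powr p) \<le> norm (2 powr p * (norm (u x) powr p + B powr p))"
      by (simp add: add_nonneg_nonneg)
  qed
qed

text \<open>The field has size |G|^(p-1) and v is bounded; on a finite measure space a multiple of 1
  + |G|^p dominates.\<close>

lemma (in finite_measure) integrable_p_Laplace_field:
  fixes G v :: "'a \<Rightarrow> 'b::euclidean_space"
  assumes p: "1 < p" and [measurable]: "G \<in> borel_measurable M" "v \<in> borel_measurable M"
    and G: "integrable M (\<lambda>x. norm (G x) powr p)" and v: "\<And>x. norm (v x) \<le> B"
  shows "integrable M (\<lambda>x. norm (G x) powr (p - 2) * (G x \<bullet> v x))"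
proof (rule Bochner_Integration.integrable_bound)
  show "integrable M (\<lambda>x. (1 + norm (G x) powr p) * B)"
    using G by simp
  show "AE x in M. norm (norm (G x) powr (p - 2) * (G x \<bullet> v x)) \<le> norm ((1 + norm (G x) powr p) * B)"
  proof (rule AE_I2)
    fix x
    have B: "B \<ge> 0" using v[of x] norm_ge_zero order_trans by blast
    have "\<bar>norm (G x) powr (p - 2) * (G x \<bullet> v x)\<bar> \<le> norm (G x) powr (p - 2) * (norm (G x) * norm (v x))"
      by (simp add: abs_mult mult_left_mono Cauchy_Schwarz_ineq2)
    also have "\<dots> = norm (G x) powr (p - 1) * norm (v x)"
      by (cases "G x = 0") (simp_all add: powr_diff power2_eq_square)
    also have "\<dots> \<le> (1 + norm (G x) powr p) * B"
      using p by (intro mult_mono powr_pred_le v) (auto simp: add_nonneg_nonneg)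
    finally show "norm (norm (G x) powr (p - 2) * (G x \<bullet> v x)) \<le> norm ((1 + norm (G x) powr p) * B)"
      using B by (simp add: abs_mult add_nonneg_nonneg)
  qed
qed measurable

text \<open>The equation is tested with \<psi> = T_\<delta>(\<phi>), whose gradient is
  T_\<delta>'(\<phi>) times that of \<phi>. Multiplying \<open>norm_powr_le_p_Laplace\<close> by
  this factor produces the product of the field of u with the gradient of \<psi>, which the weak
  equation turns into the integral of f \<psi>. The other two terms are errors, small for suitable
  \<open>e\<close> and \<phi> close to u.\<close>

lemma energy_estimate:
  fixes \<Omega> :: "'a::euclidean_space set"
  assumes u: "p_Laplace_weak_solution \<Omega> p f u" and p: "1 < p" and \<Omega>: "\<Omega> \<in> lmeasurable"
    and \<phi>: "\<phi> \<in> test_functions \<Omega>" and \<delta>: "0 < \<delta>" and ab: "0 \<le> a" "a < b" and e: "0 < e"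
  defines "G \<equiv> weak_gradient \<Omega> u" and "\<psi> \<equiv> \<lambda>x. smooth_trunc \<delta> a b (\<phi> x)"
  shows "(\<integral>\<^sup>+x. ennreal (norm (gradient \<psi> x) powr p) \<partial>lborel)
    \<le> ennreal (2 powr p * ((LINT x|lebesgue_on \<Omega>. f x * \<psi> x) + e * (LINT x|lebesgue_on \<Omega>. norm (G x) powr p)
      + (e powr (1 - p) + 1) * (LINT x|lebesgue_on \<Omega>. norm (G x - gradient \<phi> x) powr p)))"
proof -
  define M where "M = lebesgue_on \<Omega>"
  interpret finite_measure M
    unfolding M_def using \<Omega> by (rule finite_measure_lebesgue_on)
  have "G \<in> Lp_space \<Omega> (ereal p)"
    using u by (simp add: G_def p_Laplace_weak_solution_def W1p_0_def W1p_def)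
  then have G: "G \<in> borel_measurable M" "integrable M (\<lambda>x. norm (G x) powr p)"
    by (auto simp: Lp_space_def M_def)
  have \<psi>: "\<psi> \<in> test_functions \<Omega>"
    unfolding \<psi>_def by (rule smooth_trunc_comp_test_function[OF \<phi> \<delta>])
  define T' where "T' x = smooth_trunc' \<delta> a b (\<phi> x)" for x
  have T': "0 \<le> T' x" "T' x \<le> 1" for x
    unfolding T'_def using smooth_trunc'_bounds[OF \<delta> ab] by auto
  have grad: "gradient \<psi> x = T' x *\<^sub>R gradient \<phi> x" for x
    unfolding \<psi>_def T'_def by (rule smooth_trunc_comp_test_function[OF \<phi> \<delta>])
  obtain B where B: "\<And>x. norm (gradient \<phi> x) \<le> B" using test_function_regularity(5)[OF \<phi>] by blast
  obtain B' where B': "\<And>x. norm (gradient \<psi> x) \<le> B'" using test_function_regularity(5)[OF \<psi>] by blast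
  have meas: "gradient \<phi> \<in> borel_measurable M" "gradient \<psi> \<in> borel_measurable M"
    unfolding M_def by (intro borel_measurable_lebesgue_on test_function_regularity(2)[OF \<phi>]
        test_function_regularity(2)[OF \<psi>])+
  have int_d: "integrable M (\<lambda>x. norm (G x - gradient \<phi> x) powr p)"
    by (rule integrable_powr_diff[OF finite_measure_axioms p G meas(1) B])
  have int_F: "integrable M (\<lambda>x. norm (G x) powr (p - 2) * (G x \<bullet> gradient \<psi> x))"
    by (rule integrable_p_Laplace_field[OF p G(1) meas(2) G(2) B'])
  define R where "R x = 2 powr p * (norm (G x) powr (p - 2) * (G x \<bullet> gradient \<psi> x) + e * norm (G x) powr p
      + (e powr (1 - p) + 1) * norm (G x - gradient \<phi> x) powr p)" for x
  have le: "norm (gradient \<psi> x) powr p \<le> R x" for x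
  proof -
    define X where "X = norm (G x) powr (p - 2) * (G x \<bullet> gradient \<phi> x)"
    define Y where "Y = e * norm (G x) powr p + (e powr (1 - p) + 1) * norm (G x - gradient \<phi> x) powr p"
    have Y: "Y \<ge> 0" using e by (simp add: Y_def)
    have "norm (gradient \<psi> x) powr p = T' x powr p * norm (gradient \<phi> x) powr p"
      using T' by (simp add: grad powr_mult)
    \<comment> \<open>One factor T' is kept, as 0 \<le> T' \<le> 1 < p. In \<open>X\<close> it turns
      the gradient of \<phi> into that of \<psi>; on the nonnegative error \<open>Y\<close> it is
      simply dropped later.\<close>
    also have "T' x powr p \<le> T' x"
      using powr_mono'[of 1 p "T' x"] T'[of x] p by (cases "T' x = 0") auto
    then have "T' x powr p * norm (gradient \<phi> x) powr p \<le> T' x * norm (gradient \<phi> x) powr p"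
      by (intro mult_right_mono) auto
    also have "\<dots> \<le> T' x * (2 powr p * (X + Y))"
      using norm_powr_le_p_Laplace[OF p e, of "gradient \<phi> x" "G x"] T'
      by (intro mult_left_mono) (auto simp: X_def Y_def add.assoc)
    also have "\<dots> = 2 powr p * (T' x * X + T' x * Y)" by (simp add: algebra_simps)
    also have "\<dots> \<le> 2 powr p * (T' x * X + Y)"
      using T'[of x] Y by (intro mult_left_mono add_left_mono mult_left_le_one_le) auto
    also have "\<dots> = R x"
      by (simp add: R_def X_def Y_def grad mult_ac add.assoc)
    finally show ?thesis .
  qed
  have int_R: "integrable M R"
    unfolding R_def by (intro integrable_mult_right Bochner_Integration.integrable_add int_F int_d G)
  \<comment> \<open>The Sobolev inequality lives on the whole space, the equation on \<Omega>; the
    support of \<psi> lies in \<Omega>, so the two integrals agree.\<close>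
  have "(\<integral>\<^sup>+x. ennreal (norm (gradient \<psi> x) powr p) \<partial>lborel)
    = (\<integral>\<^sup>+x. ennreal (norm (gradient \<psi> x) powr p) * indicator \<Omega> x \<partial>lborel)"
  proof (intro nn_integral_cong)
    fix x
    show "ennreal (norm (gradient \<psi> x) powr p) = ennreal (norm (gradient \<psi> x) powr p) * indicator \<Omega> x"
    proof (cases "x \<in> \<Omega>")
      case False
      then have "x \<notin> closure {x. \<psi> x \<noteq> 0}" using \<psi> by (auto simp: test_functions_def)
      then show ?thesis using gradient_zero_outside_support[OF \<psi>] by simp
    qed simp
  qed
  also have "\<dots> = (\<integral>\<^sup>+x. ennreal (norm (gradient \<psi> x) powr p) \<partial>M)"
    unfolding M_def using \<Omega> by (subst nn_integral_restrict_space) (auto simp: nn_integral_completion)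
  also have "\<dots> \<le> (\<integral>\<^sup>+x. ennreal (R x) \<partial>M)"
    by (intro nn_integral_mono ennreal_leI le)
  also have "\<dots> = ennreal (LINT x|M. R x)"
    using int_R by (rule nn_integral_eq_integral) (use le powr_ge_zero order_trans in blast)
  also have "(LINT x|M. R x) = 2 powr p * ((LINT x|M. norm (G x) powr (p - 2) * (G x \<bullet> gradient \<psi> x))
      + e * (LINT x|M. norm (G x) powr p)
      + (e powr (1 - p) + 1) * (LINT x|M. norm (G x - gradient \<phi> x) powr p))"
    unfolding R_def using int_F int_d G by simp
  also have "(LINT x|M. norm (G x) powr (p - 2) * (G x \<bullet> gradient \<psi> x)) = (LINT x|M. f x * \<psi> x)"
    using u \<psi> by (simp add: p_Laplace_weak_solution_def M_def G_def)
  finally show ?thesis unfolding M_def .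
qed

text \<open>Convergence in the Sobolev norm makes |u - \<phi>_k|^p tend to 0 in L^1, so a
  subsequence converges almost everywhere; the gradient limit survives along it.\<close>

lemma W1p_0_approx_seq:
  fixes \<Omega> :: "'a::euclidean_space set"
  assumes u: "u \<in> W1p_0 \<Omega> p" and p: "1 < p" and \<Omega>: "\<Omega> \<in> lmeasurable"
  obtains \<phi> where "\<And>k::nat. \<phi> k \<in> test_functions \<Omega>"
    "AE x in lebesgue_on \<Omega>. (\<lambda>k. \<phi> k x) \<longlonglongrightarrow> u x"
    "(\<lambda>k. LINT x|lebesgue_on \<Omega>. norm (weak_gradient \<Omega> u x - gradient (\<phi> k) x) powr p) \<longlonglongrightarrow> 0"
proof -
  define M where "M = lebesgue_on \<Omega>"
  interpret finite_measure M
    unfolding M_def using \<Omega> by (rule finite_measure_lebesgue_on)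
  have "u \<in> Lp_space \<Omega> (ereal p)"
    using u by (simp add: W1p_0_def W1p_def)
  then have um: "u \<in> borel_measurable M" "integrable M (\<lambda>x. norm (u x) powr p)"
    by (auto simp: Lp_space_def M_def)
  have "\<forall>k. \<exists>\<phi>. \<phi> \<in> test_functions \<Omega> \<and> (LINT x|M. \<bar>u x - \<phi> x\<bar> powr p) < inverse (real (Suc k))
     \<and> (LINT x|M. norm (weak_gradient \<Omega> u x - gradient \<phi> x) powr p) < inverse (real (Suc k))"
  proof
    fix k
    show "\<exists>\<phi>. \<phi> \<in> test_functions \<Omega> \<and> (LINT x|M. \<bar>u x - \<phi> x\<bar> powr p) < inverse (real (Suc k))
     \<and> (LINT x|M. norm (weak_gradient \<Omega> u x - gradient \<phi> x) powr p) < inverse (real (Suc k))"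
      unfolding M_def by (rule W1p_0_approx[OF u p, of "inverse (real (Suc k))"]) auto
  qed
  from choice[OF this] obtain \<phi> where \<phi>: "\<And>k. \<phi> k \<in> test_functions \<Omega>"
    "\<And>k. (LINT x|M. \<bar>u x - \<phi> k x\<bar> powr p) < inverse (real (Suc k))"
    "\<And>k. (LINT x|M. norm (weak_gradient \<Omega> u x - gradient (\<phi> k) x) powr p) < inverse (real (Suc k))"
    by blast
  have int: "integrable M (\<lambda>x. \<bar>u x - \<phi> k x\<bar> powr p)" for k
  proof -
    obtain B where "\<And>x. \<bar>\<phi> k x\<bar> \<le> B" using test_function_regularity(4)[OF \<phi>(1)] by blast
    moreover have "\<phi> k \<in> borel_measurable M"
      unfolding M_def by (intro borel_measurable_lebesgue_on test_function_regularity(1)[OF \<phi>(1)])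
    ultimately show ?thesis
      using integrable_powr_diff[OF finite_measure_axioms p um, of "\<phi> k" B] by simp
  qed
  have null: "X \<longlonglongrightarrow> 0" if "\<And>k. 0 \<le> X k" "\<And>k. X k < inverse (real (Suc k))" for X :: "nat \<Rightarrow> real"
    by (rule tendsto_sandwich[OF _ _ tendsto_const LIMSEQ_inverse_real_of_nat])
      (use that in \<open>auto intro!: always_eventually less_imp_le\<close>)
  have lim: "(\<lambda>k. LINT x|M. norm (weak_gradient \<Omega> u x - gradient (\<phi> k) x) powr p) \<longlonglongrightarrow> 0"
    by (rule null[OF _ \<phi>(3)]) (auto intro!: Bochner_Integration.integral_nonneg)
  have "(\<lambda>k. LINT x|M. norm (\<bar>u x - \<phi> k x\<bar> powr p)) \<longlonglongrightarrow> 0"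
    by (rule null) (use \<phi>(2) in \<open>auto intro!: Bochner_Integration.integral_nonneg\<close>)
  from tendsto_L1_AE_subseq[OF int this] obtain r :: "nat \<Rightarrow> nat" where r: "strict_mono r"
    "AE x in M. (\<lambda>k. \<bar>u x - \<phi> (r k) x\<bar> powr p) \<longlonglongrightarrow> 0" by blast
  have AE: "AE x in M. (\<lambda>k. \<phi> (r k) x) \<longlonglongrightarrow> u x"
    using r(2)
  proof eventually_elim
    fix x assume "(\<lambda>k. \<bar>u x - \<phi> (r k) x\<bar> powr p) \<longlonglongrightarrow> 0"
    then have "(\<lambda>k. (\<bar>u x - \<phi> (r k) x\<bar> powr p) powr (1 / p)) \<longlonglongrightarrow> 0 powr (1 / p)"
      using p by (intro tendsto_powr' tendsto_const) auto
    then have "(\<lambda>k. u x - \<phi> (r k) x) \<longlonglongrightarrow> 0"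
      using p by (intro tendsto_rabs_zero_cancel[of "\<lambda>k. u x - \<phi> (r k) x"]) (simp add: powr_powr)
    from tendsto_diff[OF tendsto_const[of "u x"] this] show "(\<lambda>k. \<phi> (r k) x) \<longlonglongrightarrow> u x"
      by simp
  qed
  show ?thesis
    using that[of "\<lambda>k. \<phi> (r k)"] \<phi>(1) AE LIMSEQ_subseq_LIMSEQ[OF lim r(1)]
    unfolding M_def comp_def by blast
qed

text \<open>The Sobolev bound is applied to the test functions \<psi>_k = T_\<delta>(\<phi>_k) at
  half the height b - a, and Fatou's lemma transfers the estimate to u.\<close>

lemma weak_solution_level_set:
  fixes \<Omega> :: "'a::euclidean_space set"
  assumes u: "p_Laplace_weak_solution \<Omega> p f u" and p: "1 < p" and \<Omega>: "\<Omega> \<in> lmeasurable"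
    and ab: "0 \<le> a" "a < b" and f: "integrable (lebesgue_on \<Omega>) f"
    and \<kappa>: "0 < \<kappa>" and C: "0 < C"
    and Sobolev: "\<And>\<psi> J t. \<lbrakk>\<psi> \<in> test_functions \<Omega>; 0 < J; 0 < t;
      (\<integral>\<^sup>+x. ennreal (norm (gradient \<psi> x) powr p) \<partial>lborel) \<le> ennreal J\<rbrakk> \<Longrightarrow>
      emeasure lborel {x. t < \<bar>\<psi> x\<bar>} \<le> ennreal (C * (J / t powr p) powr \<kappa>)"
    and X: "0 \<le> X" "(LINT x|lebesgue_on \<Omega>. f x * trunc a b (u x)) \<le> X"
  shows "measure (lebesgue_on \<Omega>) {x\<in>\<Omega>. b < \<bar>u x\<bar>}
    \<le> C * (2 powr p * X / ((b - a) / 2) powr p) powr \<kappa>"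
proof -
  define M where "M = lebesgue_on \<Omega>"
  interpret finite_measure M
    unfolding M_def using \<Omega> by (rule finite_measure_lebesgue_on)
  have spM: "space M = \<Omega>" by (simp add: M_def)
  define t where "t = (b - a) / 2"
  have t: "t > 0" using ab by (simp add: t_def)
  have uW: "u \<in> W1p_0 \<Omega> p" using u by (simp add: p_Laplace_weak_solution_def)
  then have u_meas[measurable]: "u \<in> borel_measurable M"
    by (simp add: W1p_0_def W1p_def Lp_space_def M_def)
  have f_int: "integrable M f" using f by (simp add: M_def)
  then have f_meas[measurable]: "f \<in> borel_measurable M" by auto
  obtain \<phi> where \<phi>: "\<And>k::nat. \<phi> k \<in> test_functions \<Omega>"
    and AE_lim: "AE x in M. (\<lambda>k. \<phi> k x) \<longlonglongrightarrow> u x"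
    and grad_lim: "(\<lambda>k. LINT x|M. norm (weak_gradient \<Omega> u x - gradient (\<phi> k) x) powr p) \<longlonglongrightarrow> 0"
    using W1p_0_approx_seq[OF uW p \<Omega>] unfolding M_def by blast
  define \<delta> where "\<delta> k = inverse (real (Suc k))" for k
  have \<delta>: "\<delta> k > 0" for k by (simp add: \<delta>_def)
  have \<delta>_lim: "\<delta> \<longlonglongrightarrow> 0" unfolding \<delta>_def by (rule LIMSEQ_inverse_real_of_nat)
  define \<psi> where "\<psi> k x = smooth_trunc (\<delta> k) a b (\<phi> k x)" for k x
  have \<psi>: "\<psi> k \<in> test_functions \<Omega>" for k
    using smooth_trunc_comp_test_function(1)[OF \<phi> \<delta>] unfolding \<psi>_def .
  have \<psi>_borel[measurable]: "\<psi> k \<in> borel_measurable borel" for k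
    by (rule test_function_regularity(1)[OF \<psi>])
  have \<psi>_meas[measurable]: "\<psi> k \<in> borel_measurable M" for k
    unfolding M_def by (intro borel_measurable_lebesgue_on \<psi>_borel)
  have \<psi>_lim: "AE x in M. (\<lambda>k. \<psi> k x) \<longlonglongrightarrow> trunc a b (u x)"
    using AE_lim unfolding \<psi>_def
    by eventually_elim (rule tendsto_smooth_trunc[OF \<delta> \<delta>_lim])
  have trunc_meas[measurable]: "(\<lambda>x. trunc a b (u x)) \<in> borel_measurable M"
    unfolding trunc_def by measurable
  have f_lim: "(\<lambda>k. LINT x|M. f x * \<psi> k x) \<longlonglongrightarrow> (LINT x|M. f x * trunc a b (u x))"
  proof (rule integral_dominated_convergence)
    show "integrable M (\<lambda>x. norm (f x) * (b - a))"
      using f_int by simp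
    show "AE x in M. (\<lambda>k. f x * \<psi> k x) \<longlonglongrightarrow> f x * trunc a b (u x)"
      using \<psi>_lim by eventually_elim (rule tendsto_mult_left)
    show "AE x in M. norm (f x * \<psi> k x) \<le> norm (f x) * (b - a)" for k
      unfolding \<psi>_def
      using smooth_trunc_bound[OF \<delta> ab(2)] by (intro AE_I2) (auto simp: abs_mult intro!: mult_left_mono)
  qed measurable

  \<comment> \<open>The slack \<eta> is shared equally by the convergence of the right-hand side,
    the term \<open>e * S\<close> and the gradient error. It also keeps \<open>J\<close> positive
    when X = 0, as the Sobolev bound requires.\<close>
  have bound: "measure M {x\<in>\<Omega>. b < \<bar>u x\<bar>} \<le> C * (2 powr p * (X + \<eta>) / t powr p) powr \<kappa>"
    if \<eta>: "\<eta> > 0" for \<eta>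
  proof -
    define S where "S = (LINT x|M. norm (weak_gradient \<Omega> u x) powr p)"
    have S: "S \<ge> 0" unfolding S_def by (intro Bochner_Integration.integral_nonneg) auto
    \<comment> \<open>\<open>S + 1\<close> avoids division by zero. This \<open>e\<close> is fixed
      before k grows, so the factor \<open>e powr (1 - p) + 1\<close> of the gradient error is a
      constant.\<close>
    define e where "e = \<eta> / (3 * (S + 1))"
    have e: "e > 0" using \<eta> S by (simp add: e_def)
    have eS: "e * S \<le> \<eta> / 3"
      using \<eta> S by (simp add: e_def field_simps)
    define J where "J = 2 powr p * (X + \<eta>)"
    have J: "J > 0" using \<eta> X by (simp add: J_def)
    have "eventually (\<lambda>k. (LINT x|M. f x * \<psi> k x) < X + \<eta> / 3) sequentially"
      using f_lim by (rule order_tendstoD) (use X \<eta> in \<open>simp add: M_def\<close>)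
    moreover have "(\<lambda>k. (e powr (1 - p) + 1) * (LINT x|M. norm (weak_gradient \<Omega> u x - gradient (\<phi> k) x) powr p)) \<longlonglongrightarrow> 0"
      using grad_lim by (rule tendsto_mult_right_zero)
    then have "eventually (\<lambda>k. (e powr (1 - p) + 1) *
        (LINT x|M. norm (weak_gradient \<Omega> u x - gradient (\<phi> k) x) powr p) < \<eta> / 3) sequentially"
      by (rule order_tendstoD) (use \<eta> in simp)
    ultimately have "eventually (\<lambda>k. emeasure M {x\<in>\<Omega>. t < \<bar>\<psi> k x\<bar>}
        \<le> ennreal (C * (J / t powr p) powr \<kappa>)) sequentially"
    proof eventually_elim
      case (elim k)
      have "(\<integral>\<^sup>+x. ennreal (norm (gradient (\<psi> k) x) powr p) \<partial>lborel)
        \<le> ennreal (2 powr p * ((LINT x|M. f x * \<psi> k x) + e * S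
          + (e powr (1 - p) + 1) * (LINT x|M. norm (weak_gradient \<Omega> u x - gradient (\<phi> k) x) powr p)))"
        using energy_estimate[OF u p \<Omega> \<phi> \<delta> ab e, of k k] unfolding \<psi>_def M_def S_def .
      also have "\<dots> \<le> ennreal J"
        unfolding J_def using elim eS by (intro ennreal_leI mult_left_mono) auto
      finally have "emeasure lborel {x. t < \<bar>\<psi> k x\<bar>} \<le> ennreal (C * (J / t powr p) powr \<kappa>)"
        by (intro Sobolev \<psi> J t)
      moreover have "emeasure M {x\<in>\<Omega>. t < \<bar>\<psi> k x\<bar>} \<le> emeasure lborel {x. t < \<bar>\<psi> k x\<bar>}"
      proof -
        have "emeasure M {x\<in>\<Omega>. t < \<bar>\<psi> k x\<bar>} = emeasure lebesgue {x\<in>\<Omega>. t < \<bar>\<psi> k x\<bar>}"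
          unfolding M_def using \<Omega> by (intro emeasure_restrict_space) auto
        also have "\<dots> \<le> emeasure lebesgue {x. t < \<bar>\<psi> k x\<bar>}"
          by (intro emeasure_mono) auto
        also have "\<dots> = emeasure lborel {x. t < \<bar>\<psi> k x\<bar>}"
          by simp
        finally show ?thesis .
      qed
      ultimately show ?case by (rule order_trans[rotated])
    qed
    then have ev: "eventually (\<lambda>k. (\<integral>\<^sup>+x. indicator {x\<in>\<Omega>. t < \<bar>\<psi> k x\<bar>} x \<partial>M)
        \<le> ennreal (C * (J / t powr p) powr \<kappa>)) sequentially"
    proof eventually_elim
      case (elim k)
      have "{x\<in>space M. t < \<bar>\<psi> k x\<bar>} \<in> sets M" by measurable
      with elim show ?case by (simp add: spM)
    qed
    have [measurable]: "{x\<in>\<Omega>. t < \<bar>\<psi> k x\<bar>} \<in> sets M" "{x\<in>\<Omega>. b < \<bar>u x\<bar>} \<in> sets M" for k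
      unfolding spM[symmetric] by measurable
    have "emeasure M {x\<in>\<Omega>. b < \<bar>u x\<bar>} = (\<integral>\<^sup>+x. indicator {x\<in>\<Omega>. b < \<bar>u x\<bar>} x \<partial>M)"
      by simp
    \<comment> \<open>Almost every point with |u| > b eventually lies in {|\<psi>_k| > t}, so its
      indicator is below the lower limit of theirs, and Fatou's lemma applies.\<close>
    also have "\<dots> \<le> (\<integral>\<^sup>+x. liminf (\<lambda>k. indicator {x\<in>\<Omega>. t < \<bar>\<psi> k x\<bar>} x) \<partial>M)"
    proof (rule nn_integral_mono_AE, use AE_lim in eventually_elim)
      fix x assume lim: "(\<lambda>k. \<phi> k x) \<longlonglongrightarrow> u x"
      show "(indicator {x\<in>\<Omega>. b < \<bar>u x\<bar>} x :: ennreal) \<le> liminf (\<lambda>k. indicator {x\<in>\<Omega>. t < \<bar>\<psi> k x\<bar>} x)"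
      proof (cases "x \<in> \<Omega> \<and> b < \<bar>u x\<bar>")
        case True
        then have "eventually (\<lambda>k. t < \<bar>\<psi> k x\<bar>) sequentially"
          unfolding t_def \<psi>_def by (intro eventually_abs_smooth_trunc_gt[OF \<delta> \<delta>_lim lim ab]) simp
        then have "eventually (\<lambda>k. (1::ennreal) \<le> indicator {x\<in>\<Omega>. t < \<bar>\<psi> k x\<bar>} x) sequentially"
          by eventually_elim (use True in simp)
        then have "(1::ennreal) \<le> liminf (\<lambda>k. indicator {x\<in>\<Omega>. t < \<bar>\<psi> k x\<bar>} x)"
          by (rule Liminf_bounded)
        then show ?thesis using True by simp
      qed (auto simp: indicator_def)
    qed
    also have "\<dots> \<le> liminf (\<lambda>k. \<integral>\<^sup>+x. indicator {x\<in>\<Omega>. t < \<bar>\<psi> k x\<bar>} x \<partial>M)"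
      by (rule nn_integral_liminf) measurable
    also have "\<dots> \<le> ennreal (C * (J / t powr p) powr \<kappa>)"
      using ev by (intro Liminf_le) auto
    finally show ?thesis
      using C by (simp add: emeasure_eq_measure J_def)
  qed
  \<comment> \<open>The null sequence \<open>\<delta>\<close> now serves as \<eta>; the limit of the
    power at 0 uses \<kappa> > 0.\<close>
  have "(\<lambda>k. C * (2 powr p * (X + \<delta> k) / t powr p) powr \<kappa>) \<longlonglongrightarrow> C * (2 powr p * (X + 0) / t powr p) powr \<kappa>"
    using \<kappa> X t \<delta> by (intro tendsto_intros \<delta>_lim tendsto_powr')
      (auto intro!: always_eventually divide_nonneg_nonneg mult_nonneg_nonneg add_nonneg_nonneg less_imp_le[OF \<delta>])
  then have "measure M {x\<in>\<Omega>. b < \<bar>u x\<bar>} \<le> C * (2 powr p * (X + 0) / t powr p) powr \<kappa>"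
    using bound[OF \<delta>] by (intro LIMSEQ_le_const) auto
  then show ?thesis by (simp add: M_def t_def)
qed

section \<open>A weak-type Sobolev inequality\<close>

lemma nn_integral_lborel_affine:
  fixes h :: "'a::euclidean_space \<Rightarrow> ennreal"
  assumes [measurable]: "h \<in> borel_measurable borel" and c: "c \<noteq> 0"
  shows "(\<integral>\<^sup>+x. h x \<partial>lborel) = ennreal (\<bar>c\<bar> ^ DIM('a)) * (\<integral>\<^sup>+x. h (t + c *\<^sub>R x) \<partial>lborel)"
  by (subst lborel_affine[OF c, of t])
    (simp add: nn_integral_density nn_integral_distr nn_integral_cmult)

lemma nn_integral_lborel_translate:
  fixes h :: "'a::euclidean_space \<Rightarrow> ennreal"
  assumes "h \<in> borel_measurable borel"
  shows "(\<integral>\<^sup>+x. h (x + t) \<partial>lborel) = (\<integral>\<^sup>+x. h x \<partial>lborel)"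
  using nn_integral_lborel_affine[OF assms, of 1 t] by (simp add: add.commute)

text \<open>The fundamental theorem of calculus along the ray, which has left the bounded support by
  a finite time since y \<noteq> 0. The directional derivative is at most |g| because |y| \<le>
  1.\<close>

lemma abs_le_nn_integral_ray:
  fixes \<psi> :: "'a::euclidean_space \<Rightarrow> real"
  assumes \<psi>: "\<And>x. (\<psi> has_derivative (\<lambda>h. g x \<bullet> h)) (at x)"
    and g: "continuous_on UNIV g" and supp: "bounded {x. \<psi> x \<noteq> 0}"
    and y: "norm y \<le> 1" "y \<noteq> 0"
  shows "ennreal \<bar>\<psi> x\<bar> \<le> (\<integral>\<^sup>+s. ennreal (norm (g (x + s *\<^sub>R y))) * indicator {0..} s \<partial>lborel)"
proof -
  obtain B where B: "\<And>x. \<psi> x \<noteq> 0 \<Longrightarrow> norm x \<le> B"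
    using supp by (auto simp: bounded_iff)
  \<comment> \<open>Then |R y| = |B| + |x| + 1, so x + R y has norm above B. The absolute value
    covers a negative \<open>B\<close>, possible when \<psi> vanishes identically.\<close>
  define R where "R = (\<bar>B\<bar> + norm x + 1) / norm y"
  have R0: "0 \<le> R" unfolding R_def by simp
  have "\<psi> (x + R *\<^sub>R y) = 0"
  proof (rule ccontr)
    assume "\<psi> (x + R *\<^sub>R y) \<noteq> 0"
    then have "norm (x + R *\<^sub>R y) \<le> B" by (rule B)
    moreover have "norm (R *\<^sub>R y) = \<bar>B\<bar> + norm x + 1"
      using y R0 by (simp add: R_def)
    moreover have "norm (R *\<^sub>R y) \<le> norm (x + R *\<^sub>R y) + norm x"
      by (metis add_diff_cancel_left' norm_triangle_ineq4)
    ultimately show False by simp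
  qed
  have cont: "continuous_on A (\<lambda>s. g (x + s *\<^sub>R y))" for A
    by (rule continuous_on_compose2[OF g]) (auto intro!: continuous_intros)
  have vd: "((\<lambda>s. \<psi> (x + s *\<^sub>R y)) has_vector_derivative (g (x + s *\<^sub>R y) \<bullet> y)) (at s within A)" for s A
    unfolding has_vector_derivative_def
    by (rule has_derivative_eq_rhs, rule has_derivative_compose[OF _ \<psi>])
       (auto intro!: derivative_eq_intros)
  have FTC: "has_bochner_integral lborel (\<lambda>s. indicator {0..R} s *\<^sub>R (g (x + s *\<^sub>R y) \<bullet> y)) (\<psi> (x + R *\<^sub>R y) - \<psi> (x + 0 *\<^sub>R y))"
    by (intro has_bochner_integral_FTC_Icc[where F="\<lambda>s. \<psi> (x + s *\<^sub>R y)"] R0 vd continuous_intros cont)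
  have "ennreal \<bar>\<psi> x\<bar> = ennreal (norm (\<integral>s. indicator {0..R} s *\<^sub>R (g (x + s *\<^sub>R y) \<bullet> y) \<partial>lborel))"
    using has_bochner_integral_integral_eq[OF FTC] \<open>\<psi> (x + R *\<^sub>R y) = 0\<close> by simp
  also have "\<dots> \<le> (\<integral>\<^sup>+s. norm (indicator {0..R} s *\<^sub>R (g (x + s *\<^sub>R y) \<bullet> y)) \<partial>lborel)"
    using FTC by (intro integral_norm_bound_ennreal) (auto simp: has_bochner_integral_iff)
  also have "\<dots> \<le> (\<integral>\<^sup>+s. ennreal (norm (g (x + s *\<^sub>R y))) * indicator {0..} s \<partial>lborel)"
  proof (rule nn_integral_mono)
    fix s
    have "\<bar>g (x + s *\<^sub>R y) \<bullet> y\<bar> \<le> norm (g (x + s *\<^sub>R y)) * norm y"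
      by (rule Cauchy_Schwarz_ineq2)
    also have "\<dots> \<le> norm (g (x + s *\<^sub>R y))"
      using y by (simp add: mult_left_le)
    finally show "ennreal (norm (indicator {0..R} s *\<^sub>R (g (x + s *\<^sub>R y) \<bullet> y))) 
        \<le> ennreal (norm (g (x + s *\<^sub>R y))) * indicator {0..} s"
      by (auto simp: indicator_def intro: ennreal_leI)
  qed
  finally show ?thesis .
qed

text \<open>The ray bound is integrated over the unit ball of volume d, without its centre, which
  gives no ray. By \<open>rt\<close> the far part is at most d t / 2, and the constant term of the
  near part is d t / 4. Where |\<psi>| > t, the remaining near term is thus at least d t / 4, and
  Markov's inequality applies to it.\<close>

lemma weak_Sobolev_radius:
  fixes \<psi> :: "'a::euclidean_space \<Rightarrow> real"
  defines "d \<equiv> measure lborel (ball (0::'a) 1 - {0})" and "n \<equiv> real DIM('a)"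
  assumes \<psi>: "\<And>x. (\<psi> has_derivative (\<lambda>h. g x \<bullet> h)) (at x)"
    and g: "continuous_on UNIV g" and supp: "bounded {x. \<psi> x \<noteq> 0}"
    and p: "1 \<le> p" "p < n" and J: "0 < J" and t: "0 < t" and r: "0 < r"
    and int: "(\<integral>\<^sup>+x. ennreal (norm (g x) powr p) \<partial>lborel) \<le> ennreal J"
    and rt: "2 * (J / d) powr (1 / p) * r powr (1 - n / p) / (n / p - 1) \<le> t / 2"
  shows "emeasure lborel {x. t < \<bar>\<psi> x\<bar>} \<le> ennreal (J * (4 * r / t) powr p)"
proof -
  define D where "D = ball (0::'a) 1 - {0}"
  have D[measurable]: "D \<in> sets borel" by (simp add: D_def)
  have "d = measure lborel (ball (0::'a) 1)"
    unfolding d_def by (rule measure_Diff_null_set) auto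
  then have d: "d > 0" using content_ball_pos[of 1 "0::'a"] by simp
  have em: "emeasure lborel D = ennreal d"
    unfolding d_def D_def[symmetric]
  proof (rule emeasure_eq_ennreal_measure)
    have "emeasure lborel D \<le> emeasure lborel (ball (0::'a) 1)"
      by (rule emeasure_mono) (auto simp: D_def)
    then show "emeasure lborel D \<noteq> top"
      using emeasure_lborel_ball_finite[of "0::'a" 1] by (auto simp: top_unique)
  qed
  have g_meas[measurable]: "g \<in> borel_measurable borel"
    using g by (rule borel_measurable_continuous_onI)
  have "continuous_on UNIV \<psi>"
    using \<psi> by (intro has_derivative_continuous_on) (auto intro: has_derivative_at_withinI)
  then have \<psi>_meas[measurable]: "\<psi> \<in> borel_measurable borel"
    by (rule borel_measurable_continuous_onI)

  \<comment> \<open>For s > 0, \<open>A\<close> and \<open>B\<close> integrate |g| and |g|^p over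
    the ball of radius s around x, rescaled to unit size. \<open>P\<close> collects \<open>B\<close>
    over the short radii, where no pointwise bound is available.\<close>
  define A where "A s x = (\<integral>\<^sup>+y. ennreal (norm (g (x + s *\<^sub>R y))) * indicator D y \<partial>lborel)" for s x
  define B where "B s x = (\<integral>\<^sup>+y. ennreal (norm (g (x + s *\<^sub>R y)) powr p) * indicator D y \<partial>lborel)" for s x
  define P where "P x = (\<integral>\<^sup>+s. B s x * indicator {0..<r} s \<partial>lborel)" for x
  have A_meas[measurable]: "(\<lambda>(s, x). A s x) \<in> borel_measurable (lborel \<Otimes>\<^sub>M lborel)"
    unfolding A_def by measurable
  have B_meas[measurable]: "(\<lambda>(s, x). B s x) \<in> borel_measurable (lborel \<Otimes>\<^sub>M lborel)"
    unfolding B_def by measurable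
  have P_meas[measurable]: "P \<in> borel_measurable lborel"
    unfolding P_def by measurable

  \<comment> \<open>The level l stays free: it depends on s in the far part and is constant in the
    near part.\<close>
  have A_le: "A s x \<le> ennreal (l * d) + ennreal (l powr (1 - p)) * B s x" if l: "0 < l" for s x l
  proof -
    have "A s x \<le> (\<integral>\<^sup>+y. (ennreal l * indicator D y
        + ennreal (l powr (1 - p)) * (ennreal (norm (g (x + s *\<^sub>R y)) powr p) * indicator D y)) \<partial>lborel)"
      unfolding A_def
    proof (rule nn_integral_mono)
      fix y
      have "ennreal (norm (g (x + s *\<^sub>R y)))
         \<le> ennreal (l + l powr (1 - p) * norm (g (x + s *\<^sub>R y)) powr p)"
        using p l by (intro ennreal_leI le_add_powr) auto
      also have "\<dots> = ennreal l + ennreal (l powr (1 - p)) * ennreal (norm (g (x + s *\<^sub>R y)) powr p)"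
        using l by (simp add: ennreal_plus ennreal_mult)
      finally show "ennreal (norm (g (x + s *\<^sub>R y))) * indicator D y \<le> ennreal l * indicator D y
        + ennreal (l powr (1 - p)) * (ennreal (norm (g (x + s *\<^sub>R y)) powr p) * indicator D y)"
        by (auto simp: indicator_def)
    qed
    also have "\<dots> = ennreal l * emeasure lborel D + ennreal (l powr (1 - p)) * B s x"
      unfolding B_def by (subst nn_integral_add) (auto simp: nn_integral_cmult)
    also have "ennreal l * emeasure lborel D = ennreal (l * d)"
      using l d by (simp add: em ennreal_mult)
    finally show ?thesis .
  qed

  \<comment> \<open>The substitution z = x + s y has Jacobian s^n, and the integral over a ball is
    at most that over the whole space.\<close>
  have B_le: "B s x \<le> ennreal (J * s powr (- n))" if s: "0 < s" for s x
  proof -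
    have "ennreal (s ^ DIM('a)) * B s x
       \<le> ennreal (\<bar>s\<bar> ^ DIM('a)) * (\<integral>\<^sup>+y. ennreal (norm (g (x + s *\<^sub>R y)) powr p) \<partial>lborel)"
      unfolding B_def using s by (intro mult_mono nn_integral_mono) (auto simp: indicator_def)
    also have "\<dots> = (\<integral>\<^sup>+x. ennreal (norm (g x) powr p) \<partial>lborel)"
      using s by (intro nn_integral_lborel_affine[symmetric]) auto
    also note int
    finally have "ennreal (s powr (- n)) * (ennreal (s ^ DIM('a)) * B s x) \<le> ennreal (s powr (- n)) * ennreal J"
      by (intro mult_left_mono) auto
    moreover have "ennreal (s powr (- n)) * ennreal (s ^ DIM('a)) = 1"
      using s by (simp add: n_def powr_minus powr_realpow flip: ennreal_mult)
    ultimately have "B s x \<le> ennreal (s powr (- n)) * ennreal J"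
      by (simp only: mult.assoc[symmetric] mult_1_left)
    then show ?thesis
      using J by (simp add: ennreal_mult mult.commute)
  qed

  define K where "K = (J / d) powr (1 / p)"
  have K: "K > 0" using J d by (simp add: K_def)
  have A_far: "A s x \<le> ennreal (2 * d * K * s powr (- (n / p)))" if s: "0 < s" for s x
  proof -
    \<comment> \<open>Chosen so that d l^p = J s^(-n), which makes both terms of \<open>A_le\<close>
      at most l d.\<close>
    define l where "l = K * s powr (- (n / p))"
    have l: "l > 0" using s K by (simp add: l_def)
    have lp: "l powr p = J / d * s powr (- n)"
      unfolding l_def K_def using s J d p by (simp add: powr_mult powr_powr)
    have "A s x \<le> ennreal (l * d) + ennreal (l powr (1 - p)) * ennreal (J * s powr (- n))"
      using A_le[OF l, of s x] mult_left_mono[OF B_le[OF s, of x], of "ennreal (l powr (1 - p))"]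
      by (meson add_left_mono order_trans zero_le)
    also have "\<dots> = ennreal (l * d + l powr (1 - p) * (J * s powr (- n)))"
      using l d J by (simp add: ennreal_plus ennreal_mult)
    also have "J * s powr (- n) = d * l powr p" using lp d by simp
    also have "l * d + l powr (1 - p) * (d * l powr p) = 2 * d * K * s powr (- (n / p))"
      using l by (simp add: l_def[symmetric] powr_diff mult.assoc)
    finally show ?thesis .
  qed

  have np: "n / p - 1 > 0" using p by simp
  \<comment> \<open>The decay s^(-n/p) is integrable at infinity because p < n.\<close>
  have far: "(\<integral>\<^sup>+s. A s x * indicator {r..} s \<partial>lborel) \<le> ennreal (d * (t / 2))" for x
  proof -
    have "(\<integral>\<^sup>+s. A s x * indicator {r..} s \<partial>lborel)
      \<le> (\<integral>\<^sup>+s. ennreal (2 * d * K * s powr (- (n / p))) * indicator {r..} s \<partial>lborel)"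
      using r by (intro nn_integral_mono) (auto simp: indicator_def intro: A_far)
    also have "\<dots> = ennreal (0 - (- (2 * d * K) / (n / p - 1)) * r powr (1 - n / p))"
    proof (rule nn_integral_FTC_atLeast[where F="\<lambda>s. (- (2 * d * K) / (n / p - 1)) * s powr (1 - n / p)"])
      fix s assume "r \<le> s"
      then have s: "s > 0" using r by simp
      have "((\<lambda>s. (- (2 * d * K) / (n / p - 1)) * s powr (1 - n / p)) has_real_derivative
          (- (2 * d * K) / (n / p - 1)) * ((1 - n / p) * s powr (1 - n / p - 1))) (at s)"
        by (intro DERIV_cmult has_real_derivative_powr s)
      also have "(- (2 * d * K) / (n / p - 1)) * ((1 - n / p) * s powr (1 - n / p - 1))
          = (2 * d * K) * ((n / p - 1) / (n / p - 1)) * s powr (1 - n / p - 1)"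
      proof -
        have "(- X / m) * (- m * y) = X * (m / m) * y" for X m y :: real by simp
        from this[of "2 * d * K" "n / p - 1"] show ?thesis by (simp only: minus_diff_eq)
      qed
      also have "\<dots> = 2 * d * K * s powr (- (n / p))"
        using np p by simp
      finally show "((\<lambda>s. (- (2 * d * K) / (n / p - 1)) * s powr (1 - n / p)) has_real_derivative
          2 * d * K * s powr (- (n / p))) (at s)" .
    next
      have "((\<lambda>s. s powr (1 - n / p)) \<longlongrightarrow> 0) at_top"
        using np by (intro tendsto_neg_powr filterlim_ident) auto
      then show "((\<lambda>s. (- (2 * d * K) / (n / p - 1)) * s powr (1 - n / p)) \<longlongrightarrow> 0) at_top"
        by (rule tendsto_mult_right_zero)
    qed (use d K in auto)
    also have "\<dots> \<le> ennreal (d * (t / 2))"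
      using mult_left_mono[OF rt, of d] d by (intro ennreal_leI) (simp add: K_def mult_ac)
    finally show ?thesis .
  qed

  \<comment> \<open>Makes \<open>c * d * r\<close> equal to d t / 4.\<close>
  define c where "c = t / (4 * r)"
  have c: "c > 0" using t r by (simp add: c_def)
  have near: "(\<integral>\<^sup>+s. A s x * indicator {0..<r} s \<partial>lborel)
      \<le> ennreal (d * (t / 4)) + ennreal (c powr (1 - p)) * P x" for x
  proof -
    have "(\<integral>\<^sup>+s. A s x * indicator {0..<r} s \<partial>lborel)
      \<le> (\<integral>\<^sup>+s. (ennreal (c * d) * indicator {0..<r} s + ennreal (c powr (1 - p)) * (B s x * indicator {0..<r} s)) \<partial>lborel)"
      using A_le[OF c, of _ x] by (intro nn_integral_mono) (auto simp: indicator_def)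
    also have "\<dots> = ennreal (c * d) * ennreal r + ennreal (c powr (1 - p)) * P x"
      unfolding P_def using r by (subst nn_integral_add) (auto simp: nn_integral_cmult)
    also have "ennreal (c * d) * ennreal r = ennreal (d * (t / 4))"
      using t d r by (simp add: c_def flip: ennreal_mult)
    finally show ?thesis .
  qed

  have int_P: "(\<integral>\<^sup>+x. P x \<partial>lborel) \<le> ennreal (r * d * J)"
  proof -
    \<comment> \<open>Translation by s y leaves the integral of |g|^p unchanged, so only the volume
      d enters, for every s.\<close>
    have int_B: "(\<integral>\<^sup>+x. B s x \<partial>lborel) \<le> ennreal (d * J)" for s
    proof -
      have "(\<integral>\<^sup>+x. B s x \<partial>lborel)
         = (\<integral>\<^sup>+y. (\<integral>\<^sup>+x. ennreal (norm (g (x + s *\<^sub>R y)) powr p) * indicator D y \<partial>lborel) \<partial>lborel)"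
        unfolding B_def by (rule lborel_pair.Fubini') measurable
      also have "\<dots> = (\<integral>\<^sup>+y. (\<integral>\<^sup>+x. ennreal (norm (g x) powr p) \<partial>lborel) * indicator D y \<partial>lborel)"
        by (intro nn_integral_cong, subst nn_integral_multc)
          (auto simp: nn_integral_lborel_translate[of "\<lambda>x. ennreal (norm (g x) powr p)"])
      also have "\<dots> = (\<integral>\<^sup>+x. ennreal (norm (g x) powr p) \<partial>lborel) * ennreal d"
        by (simp add: nn_integral_cmult em)
      also have "\<dots> \<le> ennreal J * ennreal d" by (intro mult_right_mono int) auto
      also have "\<dots> = ennreal (d * J)" using d J by (simp add: mult.commute flip: ennreal_mult)
      finally show ?thesis .
    qed
    have "(\<integral>\<^sup>+x. P x \<partial>lborel) = (\<integral>\<^sup>+s. (\<integral>\<^sup>+x. B s x * indicator {0..<r} s \<partial>lborel) \<partial>lborel)"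
      unfolding P_def by (rule lborel_pair.Fubini') measurable
    also have "\<dots> \<le> (\<integral>\<^sup>+s. ennreal (d * J) * indicator {0..<r} s \<partial>lborel)"
      by (intro nn_integral_mono, subst nn_integral_multc) (auto intro!: mult_right_mono int_B)
    also have "\<dots> = ennreal (r * d * J)"
      using r d J by (simp add: nn_integral_cmult mult_ac flip: ennreal_mult)
    finally show ?thesis .
  qed

  have main: "ennreal (d * \<bar>\<psi> x\<bar>) \<le> ennreal (d * (t * 3 / 4)) + ennreal (c powr (1 - p)) * P x" for x
  proof -
    have "ennreal (d * \<bar>\<psi> x\<bar>) = (\<integral>\<^sup>+y. ennreal \<bar>\<psi> x\<bar> * indicator D y \<partial>lborel)"
      using d by (subst nn_integral_cmult) (auto simp: em ennreal_mult mult.commute)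
    also have "\<dots> \<le> (\<integral>\<^sup>+y. (\<integral>\<^sup>+s. ennreal (norm (g (x + s *\<^sub>R y))) * indicator {0..} s * indicator D y \<partial>lborel) \<partial>lborel)"
    proof (rule nn_integral_mono)
      fix y
      show "ennreal \<bar>\<psi> x\<bar> * indicator D y \<le> (\<integral>\<^sup>+s. ennreal (norm (g (x + s *\<^sub>R y))) * indicator {0..} s * indicator D y \<partial>lborel)"
        using abs_le_nn_integral_ray[OF \<psi> g supp, of y x]
        by (cases "y \<in> D") (auto simp: D_def)
    qed
    also have "\<dots> = (\<integral>\<^sup>+s. (\<integral>\<^sup>+y. ennreal (norm (g (x + s *\<^sub>R y))) * indicator {0..} s * indicator D y \<partial>lborel) \<partial>lborel)"
      by (rule lborel_pair.Fubini') measurable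
    also have "\<dots> = (\<integral>\<^sup>+s. (A s x * indicator {0..<r} s + A s x * indicator {r..} s) \<partial>lborel)"
      unfolding A_def using r by (intro nn_integral_cong) (auto simp: indicator_def)
    also have "\<dots> = (\<integral>\<^sup>+s. A s x * indicator {0..<r} s \<partial>lborel) + (\<integral>\<^sup>+s. A s x * indicator {r..} s \<partial>lborel)"
      by (rule nn_integral_add) measurable
    also have "\<dots> \<le> (ennreal (d * (t / 4)) + ennreal (c powr (1 - p)) * P x) + ennreal (d * (t / 2))"
      by (intro add_mono near far)
    also have "\<dots> = (ennreal (d * (t / 4)) + ennreal (d * (t / 2))) + ennreal (c powr (1 - p)) * P x"
      by (simp add: add_ac)
    also have "ennreal (d * (t / 4)) + ennreal (d * (t / 2)) = ennreal (d * (t * 3 / 4))"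
      using d t by (simp add: field_simps flip: ennreal_plus)
    finally show ?thesis .
  qed

  \<comment> \<open>Normalised so that |\<psi>| > t forces k P \<ge> 1, the form required by
    Markov's inequality.\<close>
  define k where "k = c powr (1 - p) * 4 / (d * t)"
  have k: "k > 0" using c d t by (simp add: k_def)
  have "{x. t < \<bar>\<psi> x\<bar>} \<subseteq> {x\<in>UNIV. 1 \<le> ennreal k * P x}"
  proof safe
    fix x assume x: "t < \<bar>\<psi> x\<bar>"
    have "ennreal (d * (t * 3 / 4)) + ennreal (d * (t / 4)) = ennreal (d * t)"
      using d t by (simp add: field_simps flip: ennreal_plus)
    also have "\<dots> \<le> ennreal (d * \<bar>\<psi> x\<bar>)"
      using x d by (intro ennreal_leI mult_left_mono) auto
    also note main[of x]
    finally have 1: "ennreal (d * (t / 4)) \<le> ennreal (c powr (1 - p)) * P x"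
      by (subst (asm) ennreal_add_left_cancel_le) auto
    have "1 = ennreal (4 / (d * t)) * ennreal (d * (t / 4))"
      using d t by (simp flip: ennreal_mult)
    also have "\<dots> \<le> ennreal (4 / (d * t)) * (ennreal (c powr (1 - p)) * P x)"
      by (intro mult_left_mono 1) auto
    also have "\<dots> = ennreal k * P x"
      unfolding mult.assoc[symmetric] using d t by (simp add: k_def mult.commute flip: ennreal_mult)
    finally show "1 \<le> ennreal k * P x" .
  qed auto
  then have "emeasure lborel {x. t < \<bar>\<psi> x\<bar>} \<le> emeasure lborel {x\<in>UNIV. 1 \<le> ennreal k * P x}"
    by (intro emeasure_mono) auto
  also have "\<dots> \<le> ennreal k * (\<integral>\<^sup>+x. P x * indicator UNIV x \<partial>lborel)"
    by (rule nn_integral_Markov_inequality) auto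
  also have "\<dots> \<le> ennreal k * ennreal (r * d * J)"
    using int_P by (intro mult_left_mono) auto
  also have "\<dots> = ennreal (k * (r * d * J))" using k r d J by (simp flip: ennreal_mult)
  also have "k * (r * d * J) = J * (4 * r / t) powr p"
  proof -
    have "k * (r * d * J) = J * c powr (- p)"
      using d t r c by (simp add: k_def c_def powr_diff powr_minus powr_divide field_simps)
    also have "c powr (- p) = (4 * r / t) powr p"
      using t r by (simp add: c_def powr_minus powr_divide)
    finally show ?thesis .
  qed
  finally show ?thesis .
qed

text \<open>The radius is chosen to give equality in the condition \<open>rt\<close> of
  \<open>weak_Sobolev_radius\<close>. The exponent is the critical Sobolev one: (J / t^p)^(n/(n-p))
  = (J^(1/p) / t)^(np/(n-p)).\<close>

lemma weak_Sobolev: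
  fixes p n :: real
  defines "n \<equiv> real DIM('a)"
  assumes p: "1 \<le> p" "p < n"
  obtains C where "0 < C"
    and "\<And>(\<psi> :: 'a::euclidean_space \<Rightarrow> real) g J (t::real).
      \<lbrakk>\<And>x. (\<psi> has_derivative (\<lambda>h. g x \<bullet> h)) (at x); continuous_on UNIV g; bounded {x. \<psi> x \<noteq> 0};
        0 < J; 0 < t; (\<integral>\<^sup>+x. ennreal (norm (g x) powr p) \<partial>lborel) \<le> ennreal J\<rbrakk> \<Longrightarrow>
      emeasure lborel {x. t < \<bar>\<psi> x\<bar>} \<le> ennreal (C * (J / t powr p) powr (n / (n - p)))"
proof -
  define d where "d = measure lborel (ball (0::'a) 1 - {0})"
  have "d = measure lborel (ball (0::'a) 1)"
    unfolding d_def by (rule measure_Diff_null_set) auto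
  then have d: "d > 0" using content_ball_pos[of 1 "0::'a"] by simp
  define m where "m = n / p - 1"
  have m: "m > 0" using p by (simp add: m_def)
  \<comment> \<open>With Q = J / t^p, equality in the condition on r reads r^m = a Q^(1/p).\<close>
  define a where "a = 4 / (m * d powr (1 / p))"
  have a: "a > 0" using m d by (simp add: a_def)
  define C where "C = 4 powr p * a powr (p / m)"
  have C: "C > 0" using a by (simp add: C_def)
  show ?thesis
  proof (rule that[OF C])
    fix \<psi> :: "'a \<Rightarrow> real" and g and J t :: real
    assume *: "\<And>x. (\<psi> has_derivative (\<lambda>h. g x \<bullet> h)) (at x)" "continuous_on UNIV g"
      "bounded {x. \<psi> x \<noteq> 0}" "0 < J" "0 < t"
      "(\<integral>\<^sup>+x. ennreal (norm (g x) powr p) \<partial>lborel) \<le> ennreal J"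
    define Q where "Q = J / t powr p"
    have Q: "Q > 0" using * by (simp add: Q_def)
    have Qt: "t * Q powr (1 / p) = J powr (1 / p)"
      using * p by (simp add: Q_def powr_divide powr_powr)
    define r where "r = (a * Q powr (1 / p)) powr (1 / m)"
    have r: "r > 0" using a Q by (simp add: r_def)
    have "r powr (1 - n / p) = r powr (- m)" by (simp add: m_def)
    also have "\<dots> = inverse (a * Q powr (1 / p))"
      using m a Q by (simp add: r_def powr_powr powr_minus)
    finally have rm: "r powr (1 - n / p) = inverse (a * Q powr (1 / p))" .
    have "2 * (J / d) powr (1 / p) * r powr (1 - n / p) / m = t / 2"
      unfolding rm using m d Q * p
      by (simp add: powr_divide a_def field_simps flip: Qt)
    then have "emeasure lborel {x. t < \<bar>\<psi> x\<bar>} \<le> ennreal (J * (4 * r / t) powr p)"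
      using * p r unfolding d_def m_def n_def
      by (intro weak_Sobolev_radius[where g=g]) auto
    also have "J * (4 * r / t) powr p = 4 powr p * Q * r powr p"
      using * r by (simp add: Q_def powr_divide powr_mult)
    also have "r powr p = a powr (p / m) * Q powr (1 / m)"
      using a Q p by (simp add: r_def powr_mult powr_powr)
    also have "4 powr p * Q * (a powr (p / m) * Q powr (1 / m)) = C * Q powr (1 + 1 / m)"
      using Q by (simp add: C_def powr_add)
    also have "1 + 1 / m = n / (n - p)"
      using p by (simp add: m_def field_simps)
    finally show "emeasure lborel {x. t < \<bar>\<psi> x\<bar>} \<le> ennreal (C * (J / t powr p) powr (n / (n - p)))"
      unfolding Q_def .
  qed
qed

section \<open>The distribution function estimate\<close>

theorem lemma2:
  fixes \<Omega> :: "'a::euclidean_space set" and p n :: real and q :: ereal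
  defines "n \<equiv> real DIM('a)"
  assumes "DIM('a) \<ge> 3"
    and "domain_set \<Omega>" and "bounded \<Omega>"
    and "1 < p" and "p < n"
    and "1 < q" and "ereal (n * p / (n * p - n + p)) \<le> q"
  shows "\<exists>C>0. \<forall>f\<in>Lp_space \<Omega> q. \<forall>u. p_Laplace_weak_solution \<Omega> p f u \<longrightarrow>
    (\<forall>\<alpha> \<beta>. 0 \<le> \<alpha> \<and> \<alpha> < \<beta> \<longrightarrow>
      distribution_function \<Omega> u \<beta> \<le>
        (C * Lp_norm \<Omega> q f * distribution_function \<Omega> u \<alpha> powr conj_exponent_recip q
          / (\<beta> - \<alpha>) powr (p - 1)) powr (n / (n - p)))"
proof -
  have "open \<Omega>" using assms(3) by (simp add: domain_set_def)
  then have \<Omega>: "\<Omega> \<in> lmeasurable"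
    using \<open>bounded \<Omega>\<close> by (intro bounded_set_imp_lmeasurable) auto
  define M where "M = lebesgue_on \<Omega>"
  define \<kappa> where "\<kappa> = n / (n - p)"
  have \<kappa>: "\<kappa> > 0" using assms by (simp add: \<kappa>_def)
  obtain C0 where C0: "C0 > 0"
    and C0_bound: "\<And>(\<psi> :: 'a \<Rightarrow> real) g J (t::real).
      \<lbrakk>\<And>x. (\<psi> has_derivative (\<lambda>h. g x \<bullet> h)) (at x); continuous_on UNIV g; bounded {x. \<psi> x \<noteq> 0};
        0 < J; 0 < t; (\<integral>\<^sup>+x. ennreal (norm (g x) powr p) \<partial>lborel) \<le> ennreal J\<rbrakk> \<Longrightarrow>
      emeasure lborel {x. t < \<bar>\<psi> x\<bar>} \<le> ennreal (C0 * (J / t powr p) powr \<kappa>)"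
    using weak_Sobolev[where 'a='a and p=p] \<open>1 < p\<close> \<open>p < n\<close> unfolding \<kappa>_def n_def
    by (metis less_imp_le)
  have Sobolev: "emeasure lborel {x. t < \<bar>\<psi> x\<bar>} \<le> ennreal (C0 * (J / t powr p) powr \<kappa>)"
    if "\<psi> \<in> test_functions \<Omega>" "0 < J" "0 < t"
      "(\<integral>\<^sup>+x. ennreal (norm (gradient \<psi> x) powr p) \<partial>lborel) \<le> ennreal J" for \<psi> J t
    by (rule C0_bound[OF test_function_has_derivative[OF that(1)] continuous_gradient[OF that(1)]
          test_function_regularity(3)[OF that(1)] that(2-4)])
  \<comment> \<open>One 2^p comes from the energy estimate, the other from the halved height, the
    last 2 from the Hoelder-type bound; the power 1/\<kappa> moves \<open>C0\<close> inside the
    outer exponent.\<close>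
  define C where "C = C0 powr (1 / \<kappa>) * (2 powr p * 2 powr p * 2)"
  have C: "C > 0" using C0 by (simp add: C_def)
  have "distribution_function \<Omega> u \<beta> \<le>
        (C * Lp_norm \<Omega> q f * distribution_function \<Omega> u \<alpha> powr conj_exponent_recip q
          / (\<beta> - \<alpha>) powr (p - 1)) powr \<kappa>"
    if f: "f \<in> Lp_space \<Omega> q" and u: "p_Laplace_weak_solution \<Omega> p f u" and \<alpha>: "0 \<le> \<alpha>" "\<alpha> < \<beta>"
    for f u \<alpha> \<beta>
  proof -
    have u_meas: "u \<in> borel_measurable M"
      using u by (simp add: p_Laplace_weak_solution_def W1p_0_def W1p_def Lp_space_def M_def)
    have dist: "distribution_function \<Omega> u \<gamma> = measure M {x\<in>\<Omega>. \<gamma> < \<bar>u x\<bar>}" for \<gamma>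
      unfolding distribution_function_def M_def using \<Omega>
      by (intro measure_restrict_space[symmetric]) auto
    define E where "E = {x\<in>\<Omega>. \<alpha> < \<bar>u x\<bar>}"
    have "{x\<in>space M. \<alpha> < \<bar>u x\<bar>} \<in> sets M" using u_meas by measurable
    then have E: "E \<in> sets (lebesgue_on \<Omega>)" by (simp add: E_def M_def)
    note f_int = Lp_space_integral_indicator_le[OF f \<open>1 < q\<close> \<Omega> E]
    define N where "N = Lp_norm \<Omega> q f * measure M E powr conj_exponent_recip q"
    have f_E: "integrable M (\<lambda>x. norm (f x) * indicator E x)"
      using integrable_real_mult_indicator[OF E integrable_norm[OF f_int(1)]] by (simp add: M_def)
    \<comment> \<open>T(u) vanishes where |u| \<le> \<alpha> and has modulus at most \<beta> -
      \<alpha>, which confines the integral to \<open>E\<close>.\<close>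
    have "(LINT x|M. f x * trunc \<alpha> \<beta> (u x)) \<le> (LINT x|M. (\<beta> - \<alpha>) * (norm (f x) * indicator E x))"
    proof (rule integral_mono')
      show "integrable M (\<lambda>x. (\<beta> - \<alpha>) * (norm (f x) * indicator E x))"
        using f_E by simp
      fix x assume "x \<in> space M"
      then have "\<bar>trunc \<alpha> \<beta> (u x)\<bar> \<le> (\<beta> - \<alpha>) * indicator E x"
        using abs_trunc_le[OF \<alpha>(2), of "u x"] trunc_eq_0[OF _ \<alpha>(2), of "u x"]
        by (cases "\<alpha> < \<bar>u x\<bar>") (simp_all add: E_def M_def)
      then have "\<bar>f x\<bar> * \<bar>trunc \<alpha> \<beta> (u x)\<bar> \<le> \<bar>f x\<bar> * ((\<beta> - \<alpha>) * indicator E x)"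
        by (rule mult_left_mono) simp
      then show "f x * trunc \<alpha> \<beta> (u x) \<le> (\<beta> - \<alpha>) * (norm (f x) * indicator E x)"
        using abs_ge_self[of "f x * trunc \<alpha> \<beta> (u x)"] by (simp add: abs_mult mult_ac)
      show "0 \<le> (\<beta> - \<alpha>) * (norm (f x) * indicator E x)" using \<alpha> by simp
    qed
    also have "\<dots> \<le> (\<beta> - \<alpha>) * (2 * N)"
      using f_int(2) \<alpha> by (simp add: M_def N_def mult.assoc)
    finally have X: "(LINT x|lebesgue_on \<Omega>. f x * trunc \<alpha> \<beta> (u x)) \<le> (\<beta> - \<alpha>) * (2 * N)"
      by (simp add: M_def)
    \<comment> \<open>The sign of \<open>N\<close> is read off from the integral it dominates, for
      finite and infinite q alike.\<close>
    have "0 \<le> (LINT x|lebesgue_on \<Omega>. norm (f x) * indicator E x)"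
      by (intro Bochner_Integration.integral_nonneg) auto
    also have "\<dots> \<le> 2 * N" using f_int(2) by (simp add: N_def M_def mult.assoc)
    finally have N: "N \<ge> 0" by simp
    have "measure M {x\<in>\<Omega>. \<beta> < \<bar>u x\<bar>} \<le> C0 * (2 powr p * ((\<beta> - \<alpha>) * (2 * N)) / ((\<beta> - \<alpha>) / 2) powr p) powr \<kappa>"
      unfolding M_def using \<alpha> N
      by (intro weak_solution_level_set[OF u \<open>1 < p\<close> \<Omega> \<alpha> f_int(1) \<kappa> C0 Sobolev _ X]) auto
    \<comment> \<open>One factor \<beta> - \<alpha> cancels, which lowers the exponent from p to p -
      1.\<close>
    also have "2 powr p * ((\<beta> - \<alpha>) * (2 * N)) / ((\<beta> - \<alpha>) / 2) powr p
       = (2 powr p * 2 powr p * 2) * N / (\<beta> - \<alpha>) powr (p - 1)"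
      using \<alpha> by (simp add: powr_divide powr_diff field_simps)
    also have "C0 * \<dots> powr \<kappa> = (C0 powr (1 / \<kappa>)) powr \<kappa> * \<dots> powr \<kappa>"
      using C0 \<kappa> by (simp add: powr_powr)
    also have "\<dots> = (C * N / (\<beta> - \<alpha>) powr (p - 1)) powr \<kappa>"
      using C0 N by (simp add: C_def powr_mult powr_divide mult.assoc)
    finally show ?thesis
      unfolding dist by (simp add: N_def E_def mult.assoc)
  qed
  then show ?thesis using C unfolding \<kappa>_def by blast
qed

end
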